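(* Let $k$ and $n$ be positive integers. Let $\mathcal{H}=(V,E)$ be a hypergraph whose edges are colored with $k$ colors (a $k$-edge-coloring $E\to[k]$, $[k]=\{1,\dots,k\}$), and let $\alpha\in V$ be such that $$\mathrm{mult}_{\mathcal H}(\alpha^t,Y)=0\quad\text{for each } t>n \text{ and each } Y\subseteq V.$$ Then there exists an $(\alpha,n)$-detachment $\mathcal F$ of $\mathcal H$, with $\alpha$ split into $\alpha_1,\dots,\alpha_n$, such that $\mathcal F$ is $\alpha$-simple and the following conditions hold: (F1) for each $i\in[n]$, $\deg_{\mathcal F}(\alpha_i)\approx \deg_{\mathcal H}(\alpha)/n$; (F2) for each $i\in[n]$ and each $j\in[k]$, $\deg_{\mathcal F(j)}(\alpha_i)\approx \deg_{\mathcal H(j)}(\alpha)/n$; (F3) for each $U\subseteq\{\alpha_1,\dots,\alpha_n\}$ and each $X\subseteq V\setminus\{\alpha\}$, $$\mathrm{mult}_{\mathcal F}(U,X)\approx \frac{\mathrm{mult}_{\mathcal H}(\alpha^{|U|},X)}{\binom{n}{|U|}};$$ (F4) for each $U\subseteq\{\alpha_1,\dots,\alpha_n\}$, each $X\subseteq V\setminus\{\alpha\}$ and each $j\in[k]$, $$\mathrm{mult}_{\mathcal F(j)}(U,X)\approx \frac{\mathrm{mult}_{\mathcal H(j)}(\alpha^{|U|},X)}{\binom{n}{|U|}};$$ (C1) for each $j\in[k]$, $c(\mathcal F(j))=c(\mathcal H(j))$ if and only if $\deg_{\mathcal H(j)}(\alpha)-\omega_\alpha(\mathcal H(j))\geq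 n-1$.
   Context: A hypergraph $\mathcal G$ consists of a finite vertex set $V(\mathcal G)$ and a finite multiset $E(\mathcal G)$ of edges, each edge a nonempty finite multiset of vertices (edges may be repeated and a vertex may occur several times in an edge). $\deg_{\mathcal G}(v)$ is the total number of occurrences of $v$ in all edges (counted with all multiplicities). An edge is incident with $v$ if $v$ occurs in it. $\mathcal G$ is non-trivial if it has at least one edge. Sub-hypergraphs, unions and intersections are taken on vertex sets and edge multisets. $c(\mathcal G)$ is the number of connected components (an isolated vertex is a component). For multisets $U_1,\dots,U_s$ of vertices, $\mathrm{mult}_{\mathcal G}(U_1,\dots,U_s)$ is the number of edges (with repetition) equal to the multiset union $U_1\cup\dots\cup U_s$; $\{\alpha^t\}$ (written $\alpha^t$) is the multiset containing $\alpha$ exactly $t$ times. For a $k$-edge-coloring, the color class $\mathcal G(j)$ is the spanning sub-hypergraph (vertex set $V(\mathcal G)$) whose edges are those of color $j$. For reals, $x\approx y$ means $\lfloor y\rfloor\le x\le\lceil y\rceil$. $(\alpha,n)$-detachment: $\mathcal F$ is obtained from $\mathcal H$ by replacing $\alpha$ by $n$ new vertices $\alpha_1,\dots,\alpha_n$, replacing each edge $\{\alpha^p\}\cup U$ ($p\ge1$, $U$ a multiset not containing $\alpha$) by an edge $\{\alpha_1^{p_1},\dots,\alpha_n^{p_n}\}\cup U$ with $p_1+\dots+p_n=p$, and keeping all other vertices and edges; each edge keeps its color. $\mathcal F$ is $\alpha$-simple if no edge of $\mathcal F$ contains any $\alpha_i$ more than once. Wings: a vertex $\alpha$ of a connected hypergraph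 $\mathcal G$ is a cut vertex if there are non-trivial sub-hypergraphs $I,J$ with $I\cup J=\mathcal G$, $V(I\cap J)=\{\alpha\}$ and $E(I\cap J)=\varnothing$. A sub-hypergraph $W$ of $\mathcal G$ with $\alpha\in V(W)$ is an $\alpha$-wing of $\mathcal G$ if $W$ is non-trivial and connected, $\alpha$ is not a cut vertex of $W$, and no edge of $E(\mathcal G)\setminus E(W)$ is incident with a vertex of $V(W)\setminus\{\alpha\}$. $\omega_\alpha(\mathcal G)$ is the number of $\alpha$-wings of $\mathcal G$.
   Formalization: In the hypothesis, Y ranges over multisets of vertices of V, i.e. no edge contains α more than n times; with sets Y only, the edge {α²,v²} with n=1 is a counterexample. Repeated edges are distinguished, so copies of a wing are counted separately in ω_α. *)

theory Defs
  imports Complex_Main "HOL-Library.Multiset"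
begin

text \<open>The edge multiset of a hypergraph is represented by a finite set of edge labels together
  with the multiset of vertices of each label. Repeated edges are therefore distinguishable: they
  may get different colors, and two copies of an edge \<open>{\<alpha>\<^sup>p}\<close> are two different \<open>\<alpha>\<close>-wings.\<close>

record ('a, 'e) hypergraph =
  hverts :: "'a set"
  hedges :: "'e set"
  hends :: "'e \<Rightarrow> 'a multiset"

definition hypergraph :: "('a, 'e) hypergraph \<Rightarrow> bool" where
  "hypergraph G \<longleftrightarrow> finite (hverts G) \<and> finite (hedges G) \<and>
     (\<forall>e\<in>hedges G. hends G e \<noteq> {#} \<and> set_mset (hends G e) \<subseteq> hverts G)"

definition hg_nontrivial :: "('a, 'e) hypergraph \<Rightarrow> bool" where
  "hg_nontrivial G \<longleftrightarrow> hedges G \<noteq> {}"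

definition hg_deg :: "('a, 'e) hypergraph \<Rightarrow> 'a \<Rightarrow> nat" where
  "hg_deg G v = (\<Sum>e\<in>hedges G. count (hends G e) v)"

text \<open>The paper's \<open>mult(U\<^sub>1, \<dots>, U\<^sub>s)\<close> is \<open>hg_mult G (U\<^sub>1 + \<dots> + U\<^sub>s)\<close>.\<close>

definition hg_mult :: "('a, 'e) hypergraph \<Rightarrow> 'a multiset \<Rightarrow> nat" where
  "hg_mult G M = card {e \<in> hedges G. hends G e = M}"

definition hg_adj :: "('a, 'e) hypergraph \<Rightarrow> ('a \<times> 'a) set" where
  "hg_adj G = {(u, v). \<exists>e\<in>hedges G. u \<in># hends G e \<and> v \<in># hends G e}"

definition hg_reach :: "('a, 'e) hypergraph \<Rightarrow> ('a \<times> 'a) set" where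
  "hg_reach G = (hg_adj G)\<^sup>* \<inter> hverts G \<times> hverts G"

definition hg_num_components :: "('a, 'e) hypergraph \<Rightarrow> nat" where
  "hg_num_components G = card (hverts G // hg_reach G)"

definition hg_connected :: "('a, 'e) hypergraph \<Rightarrow> bool" where
  "hg_connected G \<longleftrightarrow> hverts G \<noteq> {} \<and> (\<forall>u\<in>hverts G. \<forall>v\<in>hverts G. (u, v) \<in> hg_reach G)"

text \<open>Requiring the incidence functions to be equal everywhere, and not only on the edges of
  \<open>W\<close>, makes \<open>W\<close> determined by its vertices and edges, so that sub-hypergraphs can be counted.\<close>

definition sub_hypergraph :: "('a, 'e) hypergraph \<Rightarrow> ('a, 'e) hypergraph \<Rightarrow> bool" where
  "sub_hypergraph W G \<longleftrightarrow> hypergraph W \<and> hverts W \<subseteq> hverts G \<and> hedges W \<subseteq> hedges G \<and>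
     hends W = hends G"

definition hg_cut_vertex :: "('a, 'e) hypergraph \<Rightarrow> 'a \<Rightarrow> bool" where
  "hg_cut_vertex G \<alpha> \<longleftrightarrow> hg_connected G \<and> \<alpha> \<in> hverts G \<and>
     (\<exists>I J. sub_hypergraph I G \<and> sub_hypergraph J G \<and> hg_nontrivial I \<and> hg_nontrivial J \<and>
        hverts I \<union> hverts J = hverts G \<and> hedges I \<union> hedges J = hedges G \<and>
        hverts I \<inter> hverts J = {\<alpha>} \<and> hedges I \<inter> hedges J = {})"

definition hg_wing :: "('a, 'e) hypergraph \<Rightarrow> 'a \<Rightarrow> ('a, 'e) hypergraph \<Rightarrow> bool" where
  "hg_wing G \<alpha> W \<longleftrightarrow> sub_hypergraph W G \<and> \<alpha> \<in> hverts W \<and>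
     hg_nontrivial W \<and> hg_connected W \<and> \<not> hg_cut_vertex W \<alpha> \<and>
     (\<forall>e \<in> hedges G - hedges W. \<forall>v \<in> hverts W - {\<alpha>}. v \<notin># hends G e)"

definition hg_num_wings :: "('a, 'e) hypergraph \<Rightarrow> 'a \<Rightarrow> nat" where
  "hg_num_wings G \<alpha> = card {W. hg_wing G \<alpha> W}"

definition color_class ::
  "('a, 'e) hypergraph \<Rightarrow> ('e \<Rightarrow> nat) \<Rightarrow> nat \<Rightarrow> ('a, 'e) hypergraph" where
  "color_class G col j = G\<lparr>hedges := {e \<in> hedges G. col e = j}\<rparr>"

text \<open>Vertices of a detachment: \<open>Orig v\<close> is the vertex \<open>v \<noteq> \<alpha>\<close> of the original hypergraph,
  \<open>Part i\<close> is the new vertex \<open>\<alpha>\<^sub>i\<close>.\<close>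

datatype 'a dvertex = Orig 'a | Part nat

text \<open>Edge labels are kept, so a coloring of the edges of \<open>H\<close> is also a coloring of the edges of
  \<open>F\<close>. Edges not containing \<open>\<alpha>\<close> are covered by the case where all \<open>p i\<close> vanish.\<close>

definition detachment ::
  "('a, 'e) hypergraph \<Rightarrow> 'a \<Rightarrow> nat \<Rightarrow> ('a dvertex, 'e) hypergraph \<Rightarrow> bool" where
  "detachment H \<alpha> n F \<longleftrightarrow> hypergraph F \<and>
     hverts F = Orig ` (hverts H - {\<alpha>}) \<union> Part ` {1..n} \<and>
     hedges F = hedges H \<and>
     (\<forall>e\<in>hedges H. \<exists>p :: nat \<Rightarrow> nat. (\<Sum>i=1..n. p i) = count (hends H e) \<alpha> \<and>
        hends F e = (\<Sum>i=1..n. replicate_mset (p i) (Part i)) +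
                    image_mset Orig (filter_mset (\<lambda>v. v \<noteq> \<alpha>) (hends H e)))"

definition detachment_simple :: "nat \<Rightarrow> ('a dvertex, 'e) hypergraph \<Rightarrow> bool" where
  "detachment_simple n F \<longleftrightarrow> (\<forall>e\<in>hedges F. \<forall>i\<in>{1..n}. count (hends F e) (Part i) \<le> 1)"

definition approx_eq :: "real \<Rightarrow> real \<Rightarrow> bool" where
  "approx_eq x y \<longleftrightarrow> of_int \<lfloor>y\<rfloor> \<le> x \<and> x \<le> of_int \<lceil>y\<rceil>"

end

theory Submission
  imports Defs
begin

text \<open>Call the occurrences of \<open>\<alpha>\<close> in edges hinges. A detachment distributes the hinges among the
  parts \<open>1, \<dots>, n\<close>, and each requirement says that certain sets of hinges are distributed evenly. For two
  laminar families of finite sets, the ground set has a 2-coloring that is balanced on every member: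
  each family gives a matching that pairs up all but at most one element inside every member, and the
  union of two matchings is bipartite. Recoloring two classes at a time turns this into a balanced
  \<open>n\<close>-coloring, and one of its classes is a set of hinges that takes its fair share of every member; it
  becomes the last part, and the construction continues with \<open>n - 1\<close> parts. One of the laminar
  families consists of all hinges, the hinges of each color, of each wing, and, for each color, of the
  wings with at least two hinges; the other one of the hinges of each edge, of each edge type, and of
  each edge type within a color.

  For connectivity, the wings and the parts of a color class are the two sides of a bipartite graph
  whose edges are the hinges, and \<open>c(\<F>(j)) = c(\<H>(j))\<close> holds iff that graph is connected.
  A connected graph has at least as many edges as vertices minus one, which is the inequality in (C1).
  Conversely, splitting off a fair part merges the wings that it meets, and the inequality is preserved.\<close>

section \<open>Fair subsets for two laminar families\<close>

text \<open>One balanced \<open>n\<close>-coloring controls how many hinges each part receives, but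
  neither the sets of parts that (F3) and (F4) ask about nor connectivity. Splitting off one class
  at a time allows the families to be rebuilt in between: edge types are refined, and wings joined
  by the new part are merged. Rounding errors do not accumulate. The floors and ceilings
  \<open>lo\<close> and \<open>hi\<close> are fixed at the start, and the bounds
  \<open>lo * (n choose r) \<le> m \<le> hi * (n choose r)\<close>, for \<open>m\<close> edges of a
  type with \<open>r\<close> hinges, are preserved: a fair part takes about \<open>m * r / n\<close>
  hinges of the type, which by the absorption identity lies between the same multiples of
  \<open>(n - 1) choose (r - 1)\<close>, and rounding does not cross these integers. Fairness on the
  hinges of a single edge makes the detachment simple: with \<open>N\<close> parts left, an edge
  with at most \<open>N\<close> hinges loses at most one, and an edge with exactly \<open>N\<close>
  hinges loses one.\<close>

lemma two_involutions_bipartite: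
  assumes "finite S" "\<forall>x\<in>S. \<sigma> x \<in> S \<and> \<sigma> (\<sigma> x) = x" "\<forall>x\<in>S. \<rho> x \<in> S \<and> \<rho> (\<rho> x) = x"
  shows "\<exists>c :: 'a \<Rightarrow> bool. \<forall>x\<in>S. (\<sigma> x \<noteq> x \<longrightarrow> c (\<sigma> x) \<noteq> c x) \<and> (\<rho> x \<noteq> x \<longrightarrow> c (\<rho> x) \<noteq> c x)"
  using assms
proof (induction "card S" arbitrary: S \<sigma> \<rho> rule: less_induct)
  case less
  \<comment> \<open>The union of the two matchings consists of paths and even cycles. Instead of
    following them, the induction deletes a matched pair and joins the remaining neighbors of its
    two ends. \<open>\<sigma>\<close> and \<open>\<rho>\<close> are quantified here because the pair
    may come from either matching.\<close>
  have contract: "\<exists>c :: 'a \<Rightarrow> bool. \<forall>x\<in>S. (\<sigma> x \<noteq> x \<longrightarrow> c (\<sigma> x) \<noteq> c x) \<and> (\<rho> x \<noteq> x \<longrightarrow> c (\<rho> x) \<noteq> c x)"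
    if \<sigma>: "\<forall>x\<in>S. \<sigma> x \<in> S \<and> \<sigma> (\<sigma> x) = x" and \<rho>: "\<forall>x\<in>S. \<rho> x \<in> S \<and> \<rho> (\<rho> x) = x"
      and x: "x \<in> S" "\<sigma> x \<noteq> x"
    for \<sigma> \<rho> x
  proof -
    define y where "y = \<sigma> x"
    have y: "y \<in> S" "y \<noteq> x" "\<sigma> y = x" using x \<sigma> by (auto simp: y_def)
    \<comment> \<open>The \<open>\<rho>\<close>-partners of \<open>x\<close> and \<open>y\<close>
      become partners of each other; if one of \<open>x\<close>, \<open>y\<close> is fixed by
      \<open>\<rho>\<close>, the partner of the other becomes a fixed point.\<close>
    define \<rho>' where "\<rho>' z = (if \<rho> z = x then if \<rho> y = y then z else \<rho> y
       else if \<rho> z = y then if \<rho> x = x then z else \<rho> x else \<rho> z)" for z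
    let ?S = "S - {x, y}"
    have lt: "card ?S < card S"
      using x y \<open>finite S\<close> by (intro psubset_card_mono) auto
    have 1: "\<forall>z\<in>?S. \<sigma> z \<in> ?S \<and> \<sigma> (\<sigma> z) = z"
      using \<sigma> y x y_def by (metis Diff_iff insert_iff empty_iff)
    have r: "\<rho> z \<in> S" "\<rho> (\<rho> z) = z" if "z \<in> S" for z using \<rho> that by auto
    have 2: "\<forall>z\<in>?S. \<rho>' z \<in> ?S \<and> \<rho>' (\<rho>' z) = z"
    proof
      fix z assume z: "z \<in> ?S"
      then have "z \<in> S" "z \<noteq> x" "z \<noteq> y" by auto
      then show "\<rho>' z \<in> ?S \<and> \<rho>' (\<rho>' z) = z"
        using r[of z] r[of x] r[of y] x(1) y(1,2) unfolding \<rho>'_def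
        by (smt (verit) Diff_iff insert_iff empty_iff)
    qed
    obtain c :: "'a \<Rightarrow> bool" where c: "\<forall>z\<in>?S. (\<sigma> z \<noteq> z \<longrightarrow> c (\<sigma> z) \<noteq> c z) \<and> (\<rho>' z \<noteq> z \<longrightarrow> c (\<rho>' z) \<noteq> c z)"
      using less.hyps[OF lt _ 1 2] \<open>finite S\<close> by blast
    \<comment> \<open>\<open>x\<close> must differ from its own \<open>\<rho>\<close>-partner, and
      \<open>y\<close>, which receives the opposite color, from its own. \<open>True\<close> is an
      arbitrary choice for the case that neither has a partner outside the pair.\<close>
    define a where "a = (if \<rho> x \<notin> {x, y} then \<not> c (\<rho> x) else if \<rho> y \<notin> {x, y} then c (\<rho> y) else True)"
    define d where "d z = (if z = x then a else if z = y then \<not> a else c z)" for z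
    have dxy: "d x \<noteq> d y" using y by (auto simp: d_def)
    have *: "(\<sigma> z \<noteq> z \<longrightarrow> d (\<sigma> z) \<noteq> d z)" if "z \<in> S" for z
    proof (cases "z = x \<or> z = y")
      case True
      then show ?thesis using dxy y y_def by auto
    next
      case False
      then have "z \<in> ?S" using that by auto
      then have "\<sigma> z \<in> ?S" "\<sigma> z \<noteq> z \<longrightarrow> c (\<sigma> z) \<noteq> c z" using 1 c by blast+
      then show ?thesis using False by (auto simp: d_def)
    qed
    \<comment> \<open>The bridge \<open>\<rho>'\<close> makes the two outer partners differ, so the
      color chosen for \<open>x\<close> is right for \<open>y\<close> as well.\<close>
    have xy: "c (\<rho> x) \<noteq> c (\<rho> y)" if "\<rho> x \<notin> {x,y}" "\<rho> y \<notin> {x,y}"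
    proof -
      have "\<rho>' (\<rho> x) = \<rho> y" using r x y that by (auto simp: \<rho>'_def)
      moreover have "\<rho> y \<noteq> \<rho> x" using r x y by metis
      ultimately show ?thesis using c r x that by (metis Diff_iff)
    qed
    have rxy: "\<rho> x = y \<longleftrightarrow> \<rho> y = x" using r x y by metis
    have dx: "d (\<rho> x) \<noteq> d x" if "\<rho> x \<noteq> x"
    proof (cases "\<rho> x = y")
      case False
      then have "d (\<rho> x) = c (\<rho> x)" "d x = (\<not> c (\<rho> x))" using that by (simp_all add: d_def a_def)
      then show ?thesis by simp
    qed (use dxy in simp)
    have dy: "d (\<rho> y) \<noteq> d y" if "\<rho> y \<noteq> y"
    proof (cases "\<rho> y = x")
      case False
      then have ny: "\<rho> y \<notin> {x, y}" "\<rho> x \<noteq> y" using that rxy by auto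
      then have "d (\<rho> y) = c (\<rho> y)" "d y = (\<not> a)" using y by (simp_all add: d_def)
      moreover have "a = c (\<rho> y)"
      proof (cases "\<rho> x = x")
        case True
        then show ?thesis using ny by (simp add: a_def)
      next
        case False
        then show ?thesis using ny xy by (simp add: a_def)
      qed
      ultimately show ?thesis by simp
    qed (use dxy in simp)
    have **: "d (\<rho> z) \<noteq> d z" if z: "z \<in> S" "\<rho> z \<noteq> z" for z
    proof (cases "z \<in> {x,y} \<or> \<rho> z \<in> {x,y}")
      case True
      then consider "z = x" | "z = y" | "\<rho> z = x" | "\<rho> z = y" by blast
      then show ?thesis
      proof cases
        case 3
        then have "z = \<rho> x" using r z by metis
        then show ?thesis using dx 3 z by metis
      next
        case 4
        then have "z = \<rho> y" using r z by metis
        then show ?thesis using dy 4 z by metis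
      qed (use dx dy z in simp_all)
    next
      case False
      then have "\<rho>' z = \<rho> z" "z \<in> ?S" using z by (simp_all add: \<rho>'_def)
      then have "c (\<rho> z) \<noteq> c z" using z(2) c by metis
      then show ?thesis using False by (simp add: d_def)
    qed
    show ?thesis using * ** by blast
  qed
  show ?case
  proof (cases "\<exists>x\<in>S. \<sigma> x \<noteq> x")
    case True
    then show ?thesis using contract[OF less.prems(2,3)] by blast
  next
    case no: False
    show ?thesis
    proof (cases "\<exists>x\<in>S. \<rho> x \<noteq> x")
      case True
      then obtain x where "x \<in> S" "\<rho> x \<noteq> x" by blast
      then show ?thesis using contract[OF less.prems(3,2), of x] by blast
    next
      case False
      then show ?thesis using no by blast
    qed
  qed
qed

section \<open>Laminar families and balanced 2-colorings\<close>

definition laminar :: "'a set set \<Rightarrow> bool" where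
  "laminar \<A> \<longleftrightarrow> (\<forall>P\<in>\<A>. \<forall>Q\<in>\<A>. P \<inter> Q = {} \<or> P \<subseteq> Q \<or> Q \<subseteq> P)"

text \<open>A fixed point of \<open>\<sigma>\<close> is an unmatched element. Pairing proceeds from
  the inside: among the members with at least two elements of \<open>S\<close>, one with the
  smallest trace contains a pair that no other of them separates, so this pair can be matched and
  removed.\<close>

lemma laminar_involution:
  assumes "finite S" "laminar \<A>"
  shows "\<exists>\<sigma>. (\<forall>x\<in>S. \<sigma> x \<in> S \<and> \<sigma> (\<sigma> x) = x) \<and>
    (\<forall>P\<in>\<A>. \<forall>x\<in>P \<inter> S. \<forall>y\<in>P \<inter> S. (\<sigma> x = x \<or> \<sigma> x \<notin> P) \<longrightarrow> (\<sigma> y = y \<or> \<sigma> y \<notin> P) \<longrightarrow> x = y)"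
  using assms(1)
proof (induction "card S" arbitrary: S rule: less_induct)
  case less
  show ?case
  proof (cases "\<exists>P\<in>\<A>. \<exists>x\<in>P \<inter> S. \<exists>y\<in>P \<inter> S. x \<noteq> y")
    case False
    then show ?thesis by (intro exI[of _ id]) auto
  next
    case True
    define B where "B = {P\<in>\<A>. \<exists>x\<in>P \<inter> S. \<exists>y\<in>P \<inter> S. x \<noteq> y}"
    have "B \<noteq> {}" using True by (auto simp: B_def)
    then obtain P where P: "P \<in> B" "\<And>Q. Q \<in> B \<Longrightarrow> card (P \<inter> S) \<le> card (Q \<inter> S)"
      using arg_min_nat_lemma[of "\<lambda>P. P \<in> B" _ "\<lambda>P. card (P \<inter> S)"] by blast
    then obtain x y where xy: "x \<in> P" "x \<in> S" "y \<in> P" "y \<in> S" "x \<noteq> y" "P \<in> \<A>" unfolding B_def by auto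
    let ?S = "S - {x, y}"
    have lt: "card ?S < card S"
      using xy \<open>finite S\<close> by (intro psubset_card_mono) auto
    obtain \<sigma> where \<sigma>: "\<forall>z\<in>?S. \<sigma> z \<in> ?S \<and> \<sigma> (\<sigma> z) = z"
      "\<forall>P\<in>\<A>. \<forall>x\<in>P \<inter> ?S. \<forall>y\<in>P \<inter> ?S. (\<sigma> x = x \<or> \<sigma> x \<notin> P) \<longrightarrow> (\<sigma> y = y \<or> \<sigma> y \<notin> P) \<longrightarrow> x = y"
      using less.hyps[OF lt] \<open>finite S\<close> by auto
    define \<tau> where "\<tau> z = (if z = x then y else if z = y then x else \<sigma> z)" for z
    have 1: "\<forall>z\<in>S. \<tau> z \<in> S \<and> \<tau> (\<tau> z) = z" using \<sigma>(1) xy by (auto simp: \<tau>_def)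
    have 2: "u = v" if Q: "Q \<in> \<A>" and u: "u \<in> Q \<inter> S" "\<tau> u = u \<or> \<tau> u \<notin> Q" and v: "v \<in> Q \<inter> S" "\<tau> v = v \<or> \<tau> v \<notin> Q" for Q u v
    proof (rule ccontr)
      assume ne: "u \<noteq> v"
      then have QB: "Q \<in> B" using Q u v by (auto simp: B_def)
      have "x \<in> Q \<longleftrightarrow> y \<in> Q"
      proof -
        have "P \<inter> Q = {} \<or> P \<subseteq> Q \<or> Q \<subseteq> P" using assms(2) Q xy unfolding laminar_def by auto
        \<comment> \<open>By minimality \<open>Q\<close> cannot cut the trace of \<open>P\<close>
          into smaller pieces.\<close>
        moreover have "Q \<inter> S = P \<inter> S" if "Q \<subseteq> P"
          using P(2)[OF QB] that \<open>finite S\<close> by (intro card_seteq) auto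
        ultimately show ?thesis using xy by blast
      qed
      then have "z \<in> ?S" if "z \<in> Q \<inter> S" "\<tau> z = z \<or> \<tau> z \<notin> Q" for z
        using that xy(5) by (cases "z = x"; cases "z = y") (simp_all add: \<tau>_def)
      then have S: "u \<in> ?S" "v \<in> ?S" using u v by blast+
      then have "\<sigma> u = \<tau> u" "\<sigma> v = \<tau> v" by (simp_all add: \<tau>_def)
      then show False using \<sigma>(2) Q u v ne S by (metis IntD1 IntI)
    qed
    show ?thesis using 1 2 by blast
  qed
qed

text \<open>\<open>\<sigma>\<close> injects the elements of one color that have a partner in
  \<open>P\<close> into the other color, and at most one element has no partner there.\<close>

lemma involution_balanced:
  assumes "finite P" "\<And>x. x \<in> P \<Longrightarrow> \<sigma> x \<in> P \<Longrightarrow> \<sigma> (\<sigma> x) = x \<and> (\<sigma> x \<noteq> x \<longrightarrow> c (\<sigma> x) \<noteq> c x)"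
    and "\<And>x y. x \<in> P \<Longrightarrow> y \<in> P \<Longrightarrow> \<sigma> x = x \<or> \<sigma> x \<notin> P \<Longrightarrow> \<sigma> y = y \<or> \<sigma> y \<notin> P \<Longrightarrow> x = y"
  shows "card {x\<in>P. c x} \<le> card {x\<in>P. \<not> c x} + 1"
proof -
  define U where "U = {x\<in>P. \<sigma> x = x \<or> \<sigma> x \<notin> P}"
  have U: "card U \<le> 1" "finite U"
    using assms(1,3) by (auto simp: U_def card_le_Suc0_iff_eq)
  have "card ({x\<in>P. c x} - U) \<le> card {x\<in>P. \<not> c x}"
  proof (rule card_inj_on_le[of \<sigma>])
    show "inj_on \<sigma> ({x\<in>P. c x} - U)" using assms(2) unfolding inj_on_def U_def by (smt (verit) DiffD1 DiffD2 mem_Collect_eq)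
    show "\<sigma> ` ({x\<in>P. c x} - U) \<subseteq> {x\<in>P. \<not> c x}" using assms(2) by (auto simp: U_def)
  qed (use assms in auto)
  moreover have "card {x\<in>P. c x} - card U \<le> card ({x\<in>P. c x} - U)" by (rule diff_card_le_card_Diff) (rule U)
  ultimately show ?thesis using U by linarith
qed

lemma laminar_2_colouring:
  assumes "finite S" "laminar \<A>" "laminar \<B>"
  obtains c where "\<And>P. P \<in> \<A> \<union> \<B> \<Longrightarrow> card {x\<in>P \<inter> S. c x} \<le> card {x\<in>P \<inter> S. \<not> c x} + 1"
    "\<And>P. P \<in> \<A> \<union> \<B> \<Longrightarrow> card {x\<in>P \<inter> S. \<not> c x} \<le> card {x\<in>P \<inter> S. c x} + 1"
proof -
  obtain \<sigma> where \<sigma>: "\<forall>x\<in>S. \<sigma> x \<in> S \<and> \<sigma> (\<sigma> x) = x"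
    "\<forall>P\<in>\<A>. \<forall>x\<in>P \<inter> S. \<forall>y\<in>P \<inter> S. (\<sigma> x = x \<or> \<sigma> x \<notin> P) \<longrightarrow> (\<sigma> y = y \<or> \<sigma> y \<notin> P) \<longrightarrow> x = y"
    using laminar_involution[OF assms(1,2)] by metis
  obtain \<rho> where \<rho>: "\<forall>x\<in>S. \<rho> x \<in> S \<and> \<rho> (\<rho> x) = x"
    "\<forall>P\<in>\<B>. \<forall>x\<in>P \<inter> S. \<forall>y\<in>P \<inter> S. (\<rho> x = x \<or> \<rho> x \<notin> P) \<longrightarrow> (\<rho> y = y \<or> \<rho> y \<notin> P) \<longrightarrow> x = y"
    using laminar_involution[OF assms(1,3)] by metis
  obtain c :: "'a \<Rightarrow> bool" where c: "\<And>x. x \<in> S \<Longrightarrow> \<sigma> x \<noteq> x \<Longrightarrow> c (\<sigma> x) \<noteq> c x" "\<And>x. x \<in> S \<Longrightarrow> \<rho> x \<noteq> x \<Longrightarrow> c (\<rho> x) \<noteq> c x"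
    using two_involutions_bipartite[OF assms(1) \<sigma>(1) \<rho>(1)] by blast
  \<comment> \<open>\<open>d\<close> stands for \<open>c\<close> and for its negation, which gives
    the two inequalities at once.\<close>
  have *: "card {x\<in>P \<inter> S. d x} \<le> card {x\<in>P \<inter> S. \<not> d x} + 1"
    if "P \<in> \<A> \<union> \<B>" and d: "\<And>x y. d x \<noteq> d y \<longleftrightarrow> c x \<noteq> c y" for P d
  proof (cases "P \<in> \<A>")
    case True
    show ?thesis
    proof (rule involution_balanced[of "P \<inter> S" \<sigma>])
      fix x assume "x \<in> P \<inter> S"
      then show "\<sigma> (\<sigma> x) = x \<and> (\<sigma> x \<noteq> x \<longrightarrow> d (\<sigma> x) \<noteq> d x)" using \<sigma>(1) c(1) d by blast
    next
      fix x y assume "x \<in> P \<inter> S" "y \<in> P \<inter> S" "\<sigma> x = x \<or> \<sigma> x \<notin> P \<inter> S" "\<sigma> y = y \<or> \<sigma> y \<notin> P \<inter> S"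
      then show "x = y" using \<sigma> True by blast
    qed (use assms in auto)
  next
    case False
    with that(1) have "P \<in> \<B>" by auto
    show ?thesis
    proof (rule involution_balanced[of "P \<inter> S" \<rho>])
      fix x assume "x \<in> P \<inter> S"
      then show "\<rho> (\<rho> x) = x \<and> (\<rho> x \<noteq> x \<longrightarrow> d (\<rho> x) \<noteq> d x)" using \<rho>(1) c(2) d by blast
    next
      fix x y assume "x \<in> P \<inter> S" "y \<in> P \<inter> S" "\<rho> x = x \<or> \<rho> x \<notin> P \<inter> S" "\<rho> y = y \<or> \<rho> y \<notin> P \<inter> S"
      then show "x = y" using \<rho> \<open>P \<in> \<B>\<close> by blast
    qed (use assms in auto)
  qed
  show ?thesis using *[of _ c] *[of _ "\<lambda>x. \<not> c x"] by (intro that[of c]) auto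
qed

text \<open>With \<open>t = a - a'\<close> and \<open>d = a' - b'\<close> the sum of squares drops
  by \<open>2 * (t * (t + d))\<close>, which is nonnegative because \<open>d\<close> is -1, 0 or
  1.\<close>

lemma sum_squares_balanced_le:
  fixes a b a' b' :: nat
  assumes "a' + b' = a + b" "a' \<le> b' + 1" "b' \<le> a' + 1"
  shows "a'\<^sup>2 + b'\<^sup>2 \<le> a\<^sup>2 + b\<^sup>2" and "b + 2 \<le> a \<Longrightarrow> a'\<^sup>2 + b'\<^sup>2 < a\<^sup>2 + b\<^sup>2"
proof -
  define t d where "t = int a - int a'" and "d = int a' - int b'"
  have ab: "int a = int a' + t" "int b = int b' - t" using assms(1) by (auto simp: t_def)
  have d: "d \<in> {-1, 0, 1}" using assms by (auto simp: d_def)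
  have "int (a\<^sup>2 + b\<^sup>2) - int (a'\<^sup>2 + b'\<^sup>2) = 2 * (t * (t + d))"
    unfolding of_nat_add of_nat_power ab d_def by (simp add: power2_eq_square algebra_simps)
  moreover have "t * (t + d) \<ge> 0"
    using d by (cases "t \<ge> 1"; cases "t = 0") (auto intro: mult_nonpos_nonpos)
  moreover have "t * (t + d) > 0" if "b + 2 \<le> a"
  proof -
    have "d + 2 * t \<ge> 2" using that ab by (simp add: d_def)
    then have "t > 0" "t + d > 0" using d by auto
    then show ?thesis by simp
  qed
  ultimately show "a'\<^sup>2 + b'\<^sup>2 \<le> a\<^sup>2 + b\<^sup>2" "b + 2 \<le> a \<Longrightarrow> a'\<^sup>2 + b'\<^sup>2 < a\<^sup>2 + b\<^sup>2" by linarith+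
qed

text \<open>Recoloring for the sake of one member also alters the others, so a potential is needed:
  \<open>\<Phi>\<close> sums the squares of the class sizes over all members. Balancing two classes
  increases no member's term, and strictly lowers the term of a member where they differed by two or
  more.\<close>

lemma laminar_n_colouring:
  fixes S :: "'a set" and n :: nat
  assumes S: "finite S" and lam: "laminar \<A>" "laminar \<B>" and sub: "\<Union>(\<A> \<union> \<B>) \<subseteq> S" and n: "n \<ge> 1"
  obtains f where "f ` S \<subseteq> {..<n}"
    "\<And>P i j. P \<in> \<A> \<union> \<B> \<Longrightarrow> i < n \<Longrightarrow> j < n \<Longrightarrow> card {x\<in>P. f x = i} \<le> card {x\<in>P. f x = j} + 1"
proof -
  define \<Phi> :: "('a \<Rightarrow> nat) \<Rightarrow> nat"
    where "\<Phi> f = (\<Sum>P\<in>\<A> \<union> \<B>. \<Sum>i<n. (card {x\<in>P. f x = i})\<^sup>2)" for f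
  have "(\<lambda>x. 0) ` S \<subseteq> {..<n}" using n by auto
  then obtain f where f: "f ` S \<subseteq> {..<n}" and min: "\<And>g. g ` S \<subseteq> {..<n} \<Longrightarrow> \<Phi> f \<le> \<Phi> g"
    using ex_has_least_nat[of "\<lambda>f. f ` S \<subseteq> {..<n}" _ \<Phi>] by metis
  have fin: "finite (\<A> \<union> \<B>)" using S sub by (metis finite_UnionD finite_subset)
  have finP: "finite P" if "P \<in> \<A> \<union> \<B>" for P using that S sub by (meson Union_upper finite_subset)
  have "card {x\<in>P. f x = i} \<le> card {x\<in>P. f x = j} + 1" if P: "P \<in> \<A> \<union> \<B>" and ij: "i < n" "j < n" for P i j
  proof (rule ccontr)
    assume neg: "\<not> ?thesis"
    then have ne: "i \<noteq> j" by auto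
    let ?S = "{x\<in>S. f x = i \<or> f x = j}"
    obtain c where c: "\<And>P. P \<in> \<A> \<union> \<B> \<Longrightarrow> card {x\<in>P \<inter> ?S. c x} \<le> card {x\<in>P \<inter> ?S. \<not> c x} + 1"
      "\<And>P. P \<in> \<A> \<union> \<B> \<Longrightarrow> card {x\<in>P \<inter> ?S. \<not> c x} \<le> card {x\<in>P \<inter> ?S. c x} + 1"
      using laminar_2_colouring[of ?S \<A> \<B>] S lam by auto
    define g where "g x = (if x \<in> ?S then if c x then i else j else f x)" for x
    have g: "g ` S \<subseteq> {..<n}" using f ij by (auto simp: g_def)
    let ?q = "\<lambda>f Q. \<Sum>l<n. (card {x\<in>Q. f x = l})\<^sup>2"
    have split: "?q h Q = (card {x\<in>Q. h x = i})\<^sup>2 + (card {x\<in>Q. h x = j})\<^sup>2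
       + (\<Sum>l\<in>{..<n} - {i, j}. (card {x\<in>Q. h x = l})\<^sup>2)" for h :: "'a \<Rightarrow> nat" and Q
    proof -
      have "{..<n} = insert i (insert j ({..<n} - {i, j}))" using ij by auto
      then show ?thesis using ne by (metis (no_types, lifting) Diff_iff add.assoc finite_Diff finite_lessThan finite_insert insert_iff sum.insert)
    qed
    have step: "?q g Q \<le> ?q f Q \<and> (card {x\<in>Q. f x = j} + 2 \<le> card {x\<in>Q. f x = i} \<longrightarrow> ?q g Q < ?q f Q)"
      if Q: "Q \<in> \<A> \<union> \<B>" for Q
    proof -
      have QS: "Q \<subseteq> S" using Q sub by auto
      have i: "{x\<in>Q. g x = i} = {x\<in>Q \<inter> ?S. c x}" and j: "{x\<in>Q. g x = j} = {x\<in>Q \<inter> ?S. \<not> c x}"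
        using ne QS by (auto simp: g_def)
      have rest: "(\<Sum>l\<in>{..<n} - {i, j}. (card {x\<in>Q. g x = l})\<^sup>2) = (\<Sum>l\<in>{..<n} - {i, j}. (card {x\<in>Q. f x = l})\<^sup>2)"
      proof (intro sum.cong refl arg_cong[where f="\<lambda>A. (card A)\<^sup>2"])
        fix l assume "l \<in> {..<n} - {i, j}"
        then show "{x\<in>Q. g x = l} = {x\<in>Q. f x = l}" by (auto simp: g_def)
      qed
      have "card {x\<in>Q. g x = i} + card {x\<in>Q. g x = j} = card ({x\<in>Q. g x = i} \<union> {x\<in>Q. g x = j})"
        using ne finP[OF Q] by (intro card_Un_disjoint[symmetric]) auto
      also have "{x\<in>Q. g x = i} \<union> {x\<in>Q. g x = j} = {x\<in>Q. f x = i} \<union> {x\<in>Q. f x = j}"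
        using i j QS by auto
      also have "card \<dots> = card {x\<in>Q. f x = i} + card {x\<in>Q. f x = j}"
        using ne finP[OF Q] by (intro card_Un_disjoint) auto
      finally have eq: "card {x\<in>Q. g x = i} + card {x\<in>Q. g x = j} = card {x\<in>Q. f x = i} + card {x\<in>Q. f x = j}" .
      note le = sum_squares_balanced_le[OF eq, unfolded i j, OF c[OF Q]]
      show ?thesis unfolding split[of Q g] split[of Q f] rest using le unfolding i j by auto
    qed
    have "\<Phi> g < \<Phi> f" unfolding \<Phi>_def
    proof (rule sum_strict_mono_ex1[OF fin])
      show "\<exists>a\<in>\<A> \<union> \<B>. ?q g a < ?q f a" using step[OF P] P neg by (intro bexI[of _ P]) auto
    qed (use step in blast)
    then show False using min[OF g] by simp
  qed
  with f show ?thesis by (rule that)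
qed

text \<open>The real inequalities \<open>\<bar>card (Z \<inter> P) - card P / n\<bar> < 1\<close>, cleared of denominators.\<close>

lemma laminar_fair_subset:
  fixes S :: "'a set" and n :: nat
  assumes S: "finite S" and lam: "laminar \<A>" "laminar \<B>" and sub: "\<Union>(\<A> \<union> \<B>) \<subseteq> S" and n: "n \<ge> 1"
  shows "\<exists>Z\<subseteq>S. \<forall>P\<in>\<A> \<union> \<B>. n * card (Z \<inter> P) < card P + n \<and> card P < n * card (Z \<inter> P) + n"
proof -
  obtain f where f: "f ` S \<subseteq> {..<n}"
    and bal: "\<And>P i j. P \<in> \<A> \<union> \<B> \<Longrightarrow> i < n \<Longrightarrow> j < n \<Longrightarrow> card {x\<in>P. f x = i} \<le> card {x\<in>P. f x = j} + 1"
    using laminar_n_colouring[OF assms] by blast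
  \<comment> \<open>All classes are fair; class 0 is an arbitrary choice.\<close>
  define Z where "Z = {x\<in>S. f x = 0}"
  have "n * card (Z \<inter> P) < card P + n \<and> card P < n * card (Z \<inter> P) + n" if P: "P \<in> \<A> \<union> \<B>" for P
  proof -
    let ?c = "\<lambda>i. card {x\<in>P. f x = i}"
    have PS: "P \<subseteq> S" using P sub by auto
    then have fP: "finite P" using S finite_subset by auto
    have Z: "card (Z \<inter> P) = ?c 0" using PS by (intro arg_cong[where f=card]) (auto simp: Z_def)
    have "f ` P \<subseteq> {..<n}" using f PS by blast
    then have "card P = (\<Sum>i<n. ?c i)"
      using sum.group[OF fP finite_lessThan, of f n "\<lambda>_. 1::nat"] by simp
    also have "\<dots> = ?c 0 + (\<Sum>i\<in>{1..<n}. ?c i)"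
    proof -
      have "{..<n} = insert 0 {1..<n}" using n by auto
      then show ?thesis by simp
    qed
    finally have *: "card P = ?c 0 + (\<Sum>i\<in>{1..<n}. ?c i)" .
    \<comment> \<open>Class 0 differs by at most one from each of the \<open>n - 1\<close> others,
      so \<open>n\<close> times its size differs from \<open>card P\<close> by at most
      \<open>n - 1\<close>.\<close>
    have "(\<Sum>i\<in>{1..<n}. ?c i) \<le> (\<Sum>i\<in>{1..<n}. ?c 0 + 1)" using bal[OF P] n by (intro sum_mono) auto
    moreover have "(\<Sum>i\<in>{1..<n}. ?c 0) \<le> (\<Sum>i\<in>{1..<n}. ?c i + 1)" using bal[OF P] n by (intro sum_mono) auto
    ultimately have "(\<Sum>i\<in>{1..<n}. ?c i) \<le> (n - 1) * ?c 0 + (n - 1)" "(n - 1) * ?c 0 \<le> (\<Sum>i\<in>{1..<n}. ?c i) + (n - 1)"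
      unfolding sum.distrib by simp_all
    moreover have "n * ?c 0 = ?c 0 + (n - 1) * ?c 0" using n by (cases n) auto
    ultimately show ?thesis unfolding Z using * n by linarith
  qed
  moreover have "Z \<subseteq> S" by (auto simp: Z_def)
  ultimately show ?thesis by blast
qed

section \<open>Fair assignment of hinges to parts\<close>

lemma laminar_level_sets: "laminar (range (\<lambda>v. {h\<in>S. p h \<and> g h = v}))"
  by (auto simp: laminar_def)

lemma laminar_Un_coarser:
  assumes "laminar \<A>" "laminar \<B>" "\<And>P Q. P \<in> \<A> \<Longrightarrow> Q \<in> \<B> \<Longrightarrow> P \<inter> Q = {} \<or> P \<subseteq> Q"
  shows "laminar (\<A> \<union> \<B>)"
  using assms unfolding laminar_def by (metis Int_commute Un_iff)

section \<open>Connectivity of the bipartite graph of wings and parts\<close>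

text \<open>Each \<open>h \<in> S\<close> is an edge between \<open>w h\<close> and \<open>f h\<close> of a bipartite graph; \<open>linked\<close> is
  connectivity of the edges of that graph.\<close>

definition linked :: "('h \<Rightarrow> 'w) \<Rightarrow> ('h \<Rightarrow> 'i) \<Rightarrow> 'h set \<Rightarrow> ('h \<times> 'h) set" where
  "linked w f S = {(x, y). x \<in> S \<and> y \<in> S \<and> (w x = w y \<or> f x = f y)}\<^sup>*"

lemma linked_step: "x \<in> S \<Longrightarrow> y \<in> S \<Longrightarrow> w x = w y \<or> f x = f y \<Longrightarrow> (x, y) \<in> linked w f S"
  unfolding linked_def by auto

lemma linked_trans: "(x, y) \<in> linked w f S \<Longrightarrow> (y, z) \<in> linked w f S \<Longrightarrow> (x, z) \<in> linked w f S"
  unfolding linked_def by auto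

lemma linked_sym: "(x, y) \<in> linked w f S \<Longrightarrow> (y, x) \<in> linked w f S"
  unfolding linked_def by (erule symD[OF sym_rtrancl, rotated]) (auto simp: sym_def)

text \<open>The lifting step of the connectivity argument: \<open>w'\<close> merges all wings that
  \<open>Z\<close> meets. In the original graph these are joined through the part \<open>N\<close>,
  to which all hinges of \<open>Z\<close> belong, and \<open>r\<close> ties that part to the
  remaining hinges.\<close>

lemma linked_merge:
  assumes "Z \<subseteq> S" and z0: "z0 \<in> Z"
    and w': "\<And>x. x \<in> S \<Longrightarrow> w' x = (if w x \<in> w ` Z then w z0 else w x)"
    and f: "\<And>x. x \<in> Z \<Longrightarrow> f x = N" "\<And>x. x \<in> S - Z \<Longrightarrow> f x = f' x"
    and ex: "r \<in> S - Z" "z \<in> Z" "w r = w z"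
    and R: "\<And>x y. x \<in> S - Z \<Longrightarrow> y \<in> S - Z \<Longrightarrow> (x, y) \<in> linked w' f' (S - Z)"
    and xy: "x \<in> S" "y \<in> S"
  shows "(x, y) \<in> linked w f S"
proof -
  have one: "(u, v) \<in> linked w f S" if uv: "u \<in> S - Z" "v \<in> S - Z" "w' u = w' v \<or> f' u = f' v" for u v
  proof (cases "w' u = w' v")
    case False
    then show ?thesis using uv f by (intro linked_step) auto
  next
    case True
    have S: "u \<in> S" "v \<in> S" using uv by auto
    show ?thesis
    proof (cases "w u \<in> w ` Z")
      case wu: True
      then have "w v \<in> w ` Z" using True w'[OF S(1)] w'[OF S(2)] z0 by (metis image_eqI)
      \<comment> \<open>Two merged wings are joined by the path \<open>u\<close>, \<open>a\<close>,
        \<open>b\<close>, \<open>v\<close>, since \<open>a\<close> and \<open>b\<close> lie in the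
        part \<open>N\<close>.\<close>
      with wu obtain a b where ab: "a \<in> Z" "b \<in> Z" "w u = w a" "w v = w b" by blast
      then have "(u, a) \<in> linked w f S" "(a, b) \<in> linked w f S" "(b, v) \<in> linked w f S"
        using S assms(1) f by (auto intro!: linked_step)
      then show ?thesis using linked_trans by metis
    next
      case wu: False
      then have "w u = w v" using True w'[OF S(1)] w'[OF S(2)] z0 by (metis image_eqI)
      then show ?thesis using S by (intro linked_step) auto
    qed
  qed
  have sub: "(u, v) \<in> linked w f S" if "(u, v) \<in> linked w' f' (S - Z)" for u v
    using that unfolding linked_def[of w']
  proof (induction rule: rtrancl_induct)
    case base
    then show ?case by (simp add: linked_def)
  next
    case (step a b)
    then have "(a, b) \<in> linked w f S" by (intro one) auto
    with step.IH show ?case by (rule linked_trans)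
  qed
  have "(u, r) \<in> linked w f S" if u: "u \<in> S" for u
  proof (cases "u \<in> Z")
    case True
    then have "(u, z) \<in> linked w f S" "(z, r) \<in> linked w f S"
      using assms(1) f ex u by (auto intro!: linked_step)
    then show ?thesis by (rule linked_trans)
  next
    case False
    then show ?thesis using sub R u ex by blast
  qed
  then show ?thesis using xy linked_trans linked_sym by metis
qed

text \<open>A hinge that shares a wing or a part with \<open>T\<close> adds at most one new vertex
  to \<open>T\<close>. \<open>good\<close> records only the inequality; a largest good set must be
  all of \<open>S\<close>, since a path to a missing hinge leaves \<open>T\<close> at a hinge by
  which \<open>T\<close> can be enlarged.\<close>

lemma linked_imp_card_le:
  assumes S: "finite S" and linked: "\<And>x y. x \<in> S \<Longrightarrow> y \<in> S \<Longrightarrow> (x, y) \<in> linked w f S"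
  shows "card (w ` S) + card (f ` S) \<le> card S + 1"
proof (cases "S = {}")
  case False
  define good where "good T \<longleftrightarrow> T \<subseteq> S \<and> T \<noteq> {} \<and> card (w ` T) + card (f ` T) \<le> card T + 1" for T
  obtain s where "s \<in> S" using False by auto
  then have "good {s}" by (simp add: good_def)
  moreover have "\<forall>T. good T \<longrightarrow> card T < card S + 1" using S by (auto simp: good_def less_Suc_eq_le card_mono)
  ultimately obtain T where T: "good T" and max: "\<And>T'. good T' \<Longrightarrow> card T' \<le> card T"
    using ex_has_greatest_nat[of good _ card "card S + 1"] by (metis less_imp_le)
  have finT: "finite T" using T S finite_subset by (auto simp: good_def)
  have "T = S"
  proof (rule ccontr)
    assume "T \<noteq> S"
    then obtain a b where ab: "a \<in> T" "b \<in> S" "b \<notin> T" using T by (auto simp: good_def)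
    then have "(a, b) \<in> linked w f S" using linked T by (auto simp: good_def)
    then have "\<exists>x y. x \<in> T \<and> y \<in> S - T \<and> (w x = w y \<or> f x = f y)"
      using \<open>b \<notin> T\<close> unfolding linked_def
    proof (induction rule: rtrancl_induct)
      case base
      then show ?case using ab by simp
    qed auto
    then obtain x y where xy: "x \<in> T" "y \<in> S - T" "w x = w y \<or> f x = f y" by blast
    have "card (w ` insert y T) + card (f ` insert y T) \<le> card (w ` T) + card (f ` T) + 1"
    proof (cases "w x = w y")
      case True
      then have "w ` insert y T = w ` T" using xy(1) by (metis image_insert imageI insert_absorb)
      moreover have "card (f ` insert y T) \<le> card (f ` T) + 1" using finT by (simp add: card_insert_if)
      ultimately show ?thesis by simp
    next
      case False
      then have "f ` insert y T = f ` T" using xy by (metis image_insert imageI insert_absorb)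
      moreover have "card (w ` insert y T) \<le> card (w ` T) + 1" using finT by (simp add: card_insert_if)
      ultimately show ?thesis by simp
    qed
    then have "good (insert y T)" using T xy finT by (auto simp: good_def)
    from max[OF this] xy finT show False by simp
  qed
  then show ?thesis using T by (simp add: good_def)
qed simp

lemma card_eq_sum_fibres: "finite S \<Longrightarrow> card S = (\<Sum>v\<in>w ` S. card {h\<in>S. w h = v})"
  using sum.group[of S "w ` S" w "\<lambda>_. 1::nat"] by simp

text \<open>For \<open>e > 0\<close> this follows from \<open>(e - 1) * (N - 1) \<ge> 0\<close>, for
  \<open>e = 0\<close> from the second assumption.\<close>

lemma mult_le_imp_add_le:
  fixes e N D :: nat
  assumes "N * e \<le> D" "N \<le> D + 1" "N \<ge> 1"
  shows "e + N \<le> D + 1"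
proof (cases e)
  case (Suc e')
  obtain N' where "N = Suc N'" using assms(3) by (cases N) auto
  then show ?thesis using assms Suc by simp
qed (use assms in simp)

text \<open>After a step, the wings met by \<open>Z\<close> are merged into one. The first claim says that the merged wing
  still has a hinge; the second one gives the inequality of (C1) for the remaining hinges.\<close>

lemma fair_subset_wings:
  fixes w :: "'h \<Rightarrow> 'w" and N :: nat
  assumes S: "finite S" and Z: "Z \<subseteq> S" and N: "N \<ge> 2"
    and enough: "N + card (w ` S) \<le> card S + 1"
    and fair_w: "\<And>v. N * card {h\<in>Z. w h = v} < card {h\<in>S. w h = v} + N"
    and fair_Q: "card {h\<in>S. 2 \<le> card {h'\<in>S. w h' = w h}} < N * card {h\<in>Z. 2 \<le> card {h'\<in>S. w h' = w h}} + N"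
  shows "\<exists>r\<in>S - Z. \<exists>z\<in>Z. w r = w z" and "N + card (w ` S) + card Z \<le> card S + card (w ` Z) + 1"
proof -
  let ?d = "\<lambda>v. card {h\<in>S. w h = v}"
  define Q where "Q = {h\<in>S. 2 \<le> ?d (w h)}"
  have fin: "finite Q" "finite Z" using S Z finite_subset by (auto simp: Q_def)
  have d1: "?d v \<ge> 1" if "v \<in> w ` S" for v
  proof -
    have "{h\<in>S. w h = v} \<noteq> {}" using that by auto
    then show ?thesis using S by (simp add: Suc_le_eq card_gt_0_iff)
  qed
  \<comment> \<open>Wings with one hinge contribute equally to both sides of \<open>enough\<close>,
    so the inequality survives on \<open>Q\<close>.\<close>
  have "inj_on w (S - Q)"
  proof (rule inj_onI)
    fix x y assume xy: "x \<in> S - Q" "y \<in> S - Q" "w x = w y"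
    then have "?d (w x) \<le> Suc 0" by (auto simp: Q_def)
    then have "x = y" if "x \<in> {h\<in>S. w h = w x}" "y \<in> {h\<in>S. w h = w x}"
      using that S by (simp add: card_le_Suc0_iff_eq)
    then show "x = y" using xy by auto
  qed
  then have "card (S - Q) = card (w ` (S - Q))" by (simp add: card_image)
  moreover have "card (w ` S) = card (w ` Q) + card (w ` (S - Q))"
  proof -
    have "w ` S = w ` Q \<union> w ` (S - Q)" by (auto simp: Q_def)
    moreover have "w ` Q \<inter> w ` (S - Q) = {}" by (auto simp: Q_def)
    ultimately show ?thesis using S fin by (simp add: card_Un_disjoint)
  qed
  moreover have "card S = card Q + card (S - Q)"
    using S card_Int_Diff[of S Q] by (simp add: Q_def Int_def)
  ultimately have Q: "N + card (w ` Q) \<le> card Q + 1" using enough by linarith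
  then have "Q \<noteq> {}" using N by auto
  then have "card (w ` Q) \<ge> 1" using fin by (simp add: Suc_le_eq card_gt_0_iff)
  \<comment> \<open>With at least \<open>N\<close> hinges in \<open>Q\<close>, fairness gives
    \<open>Z\<close> one of them.\<close>
  then have "card Q \<ge> N" using Q by linarith
  then have "card {h\<in>Z. 2 \<le> ?d (w h)} \<noteq> 0" using fair_Q unfolding Q_def by (intro notI) simp
  then have "{h\<in>Z. 2 \<le> ?d (w h)} \<noteq> {}" by (metis card.empty)
  then obtain z where z: "z \<in> Z" "2 \<le> ?d (w z)" by blast
  show "\<exists>r\<in>S - Z. \<exists>z\<in>Z. w r = w z"
  \<comment> \<open>A wing with \<open>d \<ge> 2\<close> hinges that lies inside \<open>Z\<close>
    would violate \<open>fair_w\<close>, since \<open>N * d \<ge> d + N\<close> for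
    \<open>N \<ge> 2\<close>.\<close>
  proof (rule ccontr)
    assume "\<not> ?thesis"
    then have "{h\<in>Z. w h = w z} = {h\<in>S. w h = w z}" using z Z by blast
    then have "N * ?d (w z) < ?d (w z) + N" using fair_w[of "w z"] by simp
    moreover obtain N' where "N = 2 + N'" using N le_Suc_ex by blast
    moreover obtain d' where "?d (w z) = 2 + d'" using z(2) le_Suc_ex by blast
    ultimately show False by (simp add: algebra_simps)
  qed
  \<comment> \<open>The sum is the excess of hinges over wings. In a wing with \<open>d\<close>
    hinges, \<open>z \<ge> 1\<close> of them in \<open>Z\<close>, fairness gives
    \<open>N * (z - 1) \<le> d - 1\<close>; so \<open>N\<close> times the excess of \<open>Z\<close>
    is at most the total excess, and \<open>mult_le_imp_add_le\<close> applies.\<close>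
  have sum_d: "(\<Sum>v\<in>w ` S. ?d v - 1) + card (w ` S) = card S"
  proof -
    have "(\<Sum>v\<in>w ` S. ?d v - 1) + card (w ` S) = (\<Sum>v\<in>w ` S. (?d v - 1) + 1)" by (simp only: sum.distrib card_eq_sum)
    also have "\<dots> = (\<Sum>v\<in>w ` S. ?d v)" using d1 by (intro sum.cong refl le_add_diff_inverse2)
    finally show ?thesis using card_eq_sum_fibres[OF S, of w] by simp
  qed
  have "N * card Z = (\<Sum>v\<in>w ` Z. N * card {h\<in>Z. w h = v})"
    using card_eq_sum_fibres[OF fin(2), of w] by (simp add: sum_distrib_left)
  also have "\<dots> \<le> (\<Sum>v\<in>w ` Z. (?d v - 1) + N)"
  proof (rule sum_mono)
    fix v assume "v \<in> w ` Z"
    then have "?d v \<ge> 1" using d1 Z by blast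
    then show "N * card {h\<in>Z. w h = v} \<le> (?d v - 1) + N" using fair_w[of v] by linarith
  qed
  also have "\<dots> = (\<Sum>v\<in>w ` Z. ?d v - 1) + N * card (w ` Z)" by (simp add: sum.distrib)
  also have "(\<Sum>v\<in>w ` Z. ?d v - 1) \<le> (\<Sum>v\<in>w ` S. ?d v - 1)" using S Z by (intro sum_mono2) auto
  finally have "N * (card Z - card (w ` Z)) \<le> (\<Sum>v\<in>w ` S. ?d v - 1)" by (simp add: diff_mult_distrib2)
  then have "(card Z - card (w ` Z)) + N \<le> (\<Sum>v\<in>w ` S. ?d v - 1) + 1"
    using enough sum_d N by (intro mult_le_imp_add_le) auto
  then show "N + card (w ` S) + card Z \<le> card S + card (w ` Z) + 1"
    using sum_d by linarith
qed

text \<open>\<open>None\<close> stands for all colors, so that the conditions with and without a color are treated together.\<close>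

definition colour_matches :: "'c option \<Rightarrow> 'c \<Rightarrow> bool" where
  "colour_matches c j \<longleftrightarrow> c = None \<or> c = Some j"

section \<open>Arithmetic and laminar families of one step\<close>

lemma choose_step:
  assumes "r \<ge> 1"
  shows "r * (Suc n choose r) = Suc n * (n choose (r - 1))"
  using assms Suc_times_binomial_eq[of n "r - 1"] by (simp add: mult.commute)

lemma choose_step': "(Suc n - r) * (Suc n choose r) = Suc n * (n choose r)"
  using binomial_absorb_comp[of "Suc n" r] by simp

text \<open>\<open>m\<close> edges of a type carry \<open>m * r\<close> hinges, \<open>z\<close> of
  which are split off. As no edge loses two, \<open>z\<close> edges continue with
  \<open>r - 1\<close> hinges and \<open>m - z\<close> with \<open>r\<close>. The exact shares
  \<open>m * r / Suc n\<close> and \<open>m * (Suc n - r) / Suc n\<close> inherit the bounds by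
  absorption.\<close>

lemma fair_type_bounds:
  fixes n r m z lo hi :: nat
  assumes "lo * (Suc n choose r) \<le> m" "m \<le> hi * (Suc n choose r)"
    and "Suc n * z < m * r + Suc n" "m * r < Suc n * z + Suc n"
  shows "r \<ge> 1 \<Longrightarrow> lo * (n choose (r - 1)) \<le> z" "r \<ge> 1 \<Longrightarrow> z \<le> hi * (n choose (r - 1))"
    and "r \<le> Suc n \<Longrightarrow> lo * (n choose r) \<le> m - z" "r \<le> Suc n \<Longrightarrow> m - z \<le> hi * (n choose r)"
proof -
  \<comment> \<open>Integrality enters here: an error smaller than \<open>Suc n\<close> disappears
    after division by \<open>Suc n\<close>.\<close>
  have cancel: "a \<le> b" if "Suc n * a < Suc n * b + Suc n" for a b :: nat
    using that by (metis Suc_mult_less_cancel1 less_Suc_eq_le mult_Suc_right add.commute)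
  {
    assume r: "r \<ge> 1"
    have "Suc n * (lo * (n choose (r - 1))) = lo * (Suc n choose r) * r"
      using choose_step[OF r, of n] by (metis mult.assoc mult.commute)
    also have "\<dots> \<le> m * r" using assms by (intro mult_right_mono) auto
    finally show "lo * (n choose (r - 1)) \<le> z" using assms by (intro cancel) linarith
    have "m * r \<le> hi * (Suc n choose r) * r" using assms by (intro mult_right_mono) auto
    also have "\<dots> = Suc n * (hi * (n choose (r - 1)))"
      using choose_step[OF r, of n] by (metis mult.assoc mult.commute)
    finally show "z \<le> hi * (n choose (r - 1))" using assms by (intro cancel) linarith
  }
  {
    assume r: "r \<le> Suc n"
    have split: "Suc n * m = m * r + m * (Suc n - r)"
      using r by (metis add_mult_distrib2 le_add_diff_inverse mult.commute)
    have diff: "Suc n * (m - z) = Suc n * m - Suc n * z" by (rule diff_mult_distrib2)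
    have "z \<le> m"
    proof (rule cancel)
      show "Suc n * z < Suc n * m + Suc n" using assms split by linarith
    qed
    then have zm: "Suc n * z \<le> Suc n * m" by (rule mult_le_mono2)
    have "Suc n * (lo * (n choose r)) = lo * (Suc n choose r) * (Suc n - r)"
      using choose_step'[of n r] by (metis mult.assoc mult.commute)
    also have "\<dots> \<le> m * (Suc n - r)" using assms by (intro mult_right_mono) auto
    finally show "lo * (n choose r) \<le> m - z" using assms split diff zm by (intro cancel) linarith
    have "m * (Suc n - r) \<le> hi * (Suc n choose r) * (Suc n - r)" using assms by (intro mult_right_mono) auto
    also have "\<dots> = Suc n * (hi * (n choose r))"
      using choose_step'[of n r] by (metis mult.assoc mult.commute)
    finally show "m - z \<le> hi * (n choose r)" using assms split diff zm by (intro cancel) linarith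
  }
qed

text \<open>Degrees are the case \<open>r = 1\<close>, with hinges in the role of edges.\<close>

lemma fair_degree_bounds:
  fixes n m z lo hi :: nat
  assumes "lo * Suc n \<le> m" "m \<le> hi * Suc n"
    and "Suc n * z < m + Suc n" "m < Suc n * z + Suc n"
  shows "lo \<le> z" "z \<le> hi" "lo * n \<le> m - z" "m - z \<le> hi * n"
  using fair_type_bounds[of lo n 1 m hi z] assms by auto

lemma fair_split:
  fixes ed :: "'h \<Rightarrow> 'e" and col :: "'e \<Rightarrow> 'c" and \<tau> :: "'e \<Rightarrow> 't" and w :: "'h \<Rightarrow> 'w"
  assumes S: "finite S" and wc: "\<And>h h'. h \<in> S \<Longrightarrow> h' \<in> S \<Longrightarrow> w h = w h' \<Longrightarrow> col (ed h) = col (ed h')"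
    and N: "N \<ge> 1"
  obtains Z where "Z \<subseteq> S"
    "\<And>v. N * card {h\<in>Z. w h = v} < card {h\<in>S. w h = v} + N"
    "\<And>j. card {h\<in>S. 2 \<le> card {h'\<in>S. w h' = w h} \<and> col (ed h) = j} <
       N * card {h\<in>Z. 2 \<le> card {h'\<in>S. w h' = w h} \<and> col (ed h) = j} + N"
    "\<And>c. N * card {h\<in>Z. colour_matches c (col (ed h))} < card {h\<in>S. colour_matches c (col (ed h))} + N"
    "\<And>c. card {h\<in>S. colour_matches c (col (ed h))} < N * card {h\<in>Z. colour_matches c (col (ed h))} + N"
    "\<And>e. N * card {h\<in>Z. ed h = e} < card {h\<in>S. ed h = e} + N"
    "\<And>e. card {h\<in>S. ed h = e} < N * card {h\<in>Z. ed h = e} + N"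
    "\<And>x c. N * card {h\<in>Z. \<tau> (ed h) = x \<and> colour_matches c (col (ed h))}
       < card {h\<in>S. \<tau> (ed h) = x \<and> colour_matches c (col (ed h))} + N"
    "\<And>x c. card {h\<in>S. \<tau> (ed h) = x \<and> colour_matches c (col (ed h))}
       < N * card {h\<in>Z. \<tau> (ed h) = x \<and> colour_matches c (col (ed h))} + N"
proof -
  (* The level \<A>2 makes Z meet a wing with at least two hinges, even if every wing has fewer than N. *)
  let ?big = "\<lambda>h. 2 \<le> card {h'\<in>S. w h' = w h}"
  \<comment> \<open>\<open>True\<close> makes the sets match the form of
    \<open>laminar_level_sets\<close>.\<close>
  define \<A>1 where "\<A>1 = range (\<lambda>v. {h\<in>S. True \<and> w h = v})"
  define \<A>2 where "\<A>2 = range (\<lambda>j. {h\<in>S. ?big h \<and> col (ed h) = j})"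
  define \<A>3 where "\<A>3 = range (\<lambda>j. {h\<in>S. True \<and> col (ed h) = j})"
  define \<B>1 where "\<B>1 = range (\<lambda>e. {h\<in>S. True \<and> ed h = e})"
  define \<B>2 where "\<B>2 = range (\<lambda>p. {h\<in>S. True \<and> (\<tau> (ed h), col (ed h)) = p})"
  define \<B>3 where "\<B>3 = range (\<lambda>x. {h\<in>S. True \<and> \<tau> (ed h) = x})"
  have single: "laminar {S}" by (simp add: laminar_def)
  have A: "laminar (\<A>1 \<union> (\<A>2 \<union> (\<A>3 \<union> {S})))"
  proof (intro laminar_Un_coarser single)
    show "laminar \<A>1" "laminar \<A>2" "laminar \<A>3"
      unfolding \<A>1_def \<A>2_def \<A>3_def by (rule laminar_level_sets)+
  next
    fix P Q assume "P \<in> \<A>3" "Q \<in> {S}"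
    then show "P \<inter> Q = {} \<or> P \<subseteq> Q" by (auto simp: \<A>3_def)
  next
    fix P Q assume "P \<in> \<A>2" "Q \<in> \<A>3 \<union> {S}"
    then show "P \<inter> Q = {} \<or> P \<subseteq> Q" by (auto simp: \<A>2_def \<A>3_def)
  next
    \<comment> \<open>Color and number of hinges are constant on a wing, so each coarser set
      contains the wing or misses it.\<close>
    fix P Q assume P: "P \<in> \<A>1" and Q: "Q \<in> \<A>2 \<union> (\<A>3 \<union> {S})"
    obtain v where v: "P = {h\<in>S. w h = v}" using P by (auto simp: \<A>1_def)
    have big: "?big h \<longleftrightarrow> ?big h'" if "h \<in> P" "h' \<in> P" for h h' using that by (simp add: v)
    have cl: "col (ed h) = col (ed h')" if "h \<in> P" "h' \<in> P" for h h' using that wc by (simp add: v)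
    have PS: "P \<subseteq> S" by (auto simp: v)
    consider j where "Q = {h\<in>S. ?big h \<and> col (ed h) = j}" | j where "Q = {h\<in>S. col (ed h) = j}" | "Q = S"
      using Q by (auto simp: \<A>2_def \<A>3_def)
    then show "P \<inter> Q = {} \<or> P \<subseteq> Q"
    proof cases
      case 1
      then show ?thesis using big cl PS by blast
    next
      case 2
      then show ?thesis using cl PS by blast
    qed (use PS in blast)
  qed
  have B: "laminar (\<B>1 \<union> (\<B>2 \<union> \<B>3))"
  proof (intro laminar_Un_coarser)
    show "laminar \<B>1" "laminar \<B>2" "laminar \<B>3"
      unfolding \<B>1_def \<B>2_def \<B>3_def by (rule laminar_level_sets)+
  next
    fix P Q assume "P \<in> \<B>2" "Q \<in> \<B>3"
    then show "P \<inter> Q = {} \<or> P \<subseteq> Q" by (auto simp: \<B>2_def \<B>3_def)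
  next
    fix P Q assume "P \<in> \<B>1" "Q \<in> \<B>2 \<union> \<B>3"
    then show "P \<inter> Q = {} \<or> P \<subseteq> Q" by (auto simp: \<B>1_def \<B>2_def \<B>3_def)
  qed
  let ?F = "(\<A>1 \<union> (\<A>2 \<union> (\<A>3 \<union> {S}))) \<union> (\<B>1 \<union> (\<B>2 \<union> \<B>3))"
  have "\<Union>?F \<subseteq> S" by (auto simp: \<A>1_def \<A>2_def \<A>3_def \<B>1_def \<B>2_def \<B>3_def)
  from laminar_fair_subset[OF S A B this N] obtain Z where Z: "Z \<subseteq> S"
    and fair: "\<forall>P\<in>?F. N * card (Z \<inter> P) < card P + N \<and> card P < N * card (Z \<inter> P) + N"
    by (elim exE conjE)
  have *: "N * card {h\<in>Z. p h} < card {h\<in>S. p h} + N \<and> card {h\<in>S. p h} < N * card {h\<in>Z. p h} + N"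
    if "{h\<in>S. p h} \<in> ?F" for p
  proof -
    have "Z \<inter> {h\<in>S. p h} = {h\<in>Z. p h}" using Z by auto
    then show ?thesis using bspec[OF fair that] by simp
  qed
  have A1: "{h\<in>S. w h = v} \<in> ?F" for v by (auto simp: \<A>1_def)
  have A2: "{h\<in>S. ?big h \<and> col (ed h) = j} \<in> ?F" for j by (auto simp: \<A>2_def)
  have A3: "{h\<in>S. colour_matches c (col (ed h))} \<in> ?F" for c
    by (cases c) (auto simp: \<A>3_def colour_matches_def)
  have B1: "{h\<in>S. ed h = e} \<in> ?F" for e by (auto simp: \<B>1_def)
  have B2: "{h\<in>S. \<tau> (ed h) = x \<and> colour_matches c (col (ed h))} \<in> ?F" for x c
  proof (cases c)
    case None
    then show ?thesis by (auto simp: \<B>3_def colour_matches_def)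
  next
    case (Some j)
    then have "{h\<in>S. \<tau> (ed h) = x \<and> colour_matches c (col (ed h))} = {h\<in>S. True \<and> (\<tau> (ed h), col (ed h)) = (x, j)}"
      by (auto simp: colour_matches_def)
    then have "{h\<in>S. \<tau> (ed h) = x \<and> colour_matches c (col (ed h))} \<in> \<B>2" unfolding \<B>2_def by blast
    then show ?thesis by blast
  qed
  show ?thesis
    using *[OF A1] *[OF A2] *[OF A3] *[OF B1] *[OF B2] by (intro that[OF Z]) blast+
qed

lemma card_fibres_uniform:
  assumes "finite S" "finite A" "ed ` S \<subseteq> A" "\<And>e. e \<in> A \<Longrightarrow> p e \<Longrightarrow> card {h\<in>S. ed h = e} = r"
  shows "card {h\<in>S. p (ed h)} = card {e\<in>A. p e} * r"
proof -
  have "card {h\<in>S. p (ed h)} = (\<Sum>e\<in>{e\<in>A. p e}. card {h \<in> {h\<in>S. p (ed h)}. ed h = e})"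
    using sum.group[of "{h\<in>S. p (ed h)}" "{e\<in>A. p e}" ed "\<lambda>_. 1::nat"] assms by fastforce
  also have "\<dots> = (\<Sum>e\<in>{e\<in>A. p e}. r)"
  proof (rule sum.cong)
    fix e assume "e \<in> {e\<in>A. p e}"
    moreover then have "{h \<in> {h\<in>S. p (ed h)}. ed h = e} = {h\<in>S. ed h = e}" by auto
    ultimately show "card {h \<in> {h\<in>S. p (ed h)}. ed h = e} = r" using assms by simp
  qed simp
  finally show ?thesis by simp
qed

text \<open>\<open>S\<close> is the set of hinges, \<open>ed h\<close> and \<open>w h\<close> are the edge and the wing of \<open>h\<close>, and an edge \<open>e\<close>
  of type \<open>\<tau> e\<close> has \<open>r (\<tau> e)\<close> hinges. Types are natural numbers because a step of the induction
  splits the type \<open>x\<close> into the types \<open>2 * x\<close> and \<open>2 * x + 1\<close>, according to whether the edge has a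
  hinge in the part that is split off.\<close>

lemma fair_assignment:
  fixes ed :: "'h \<Rightarrow> 'e" and col :: "'e \<Rightarrow> 'c" and \<tau> :: "'e \<Rightarrow> nat" and w :: "'h \<Rightarrow> 'w"
  assumes "finite A" "finite S" "ed ` S \<subseteq> A"
    and "\<And>e. e \<in> A \<Longrightarrow> card {h\<in>S. ed h = e} = r (\<tau> e)"
    and "\<And>e. e \<in> A \<Longrightarrow> r (\<tau> e) \<le> n"
    and "\<And>h h'. h \<in> S \<Longrightarrow> h' \<in> S \<Longrightarrow> w h = w h' \<Longrightarrow> col (ed h) = col (ed h')"
    and "\<And>x c. lo x c * (n choose r x) \<le> card {e\<in>A. \<tau> e = x \<and> colour_matches c (col e)}"
    and "\<And>x c. card {e\<in>A. \<tau> e = x \<and> colour_matches c (col e)} \<le> hi x c * (n choose r x)"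
    and "\<And>c. dlo c * n \<le> card {h\<in>S. colour_matches c (col (ed h))}"
    and "\<And>c. card {h\<in>S. colour_matches c (col (ed h))} \<le> dhi c * n"
  shows "\<exists>f. f ` S \<subseteq> {1..n} \<and> (\<forall>e\<in>A. inj_on f {h\<in>S. ed h = e}) \<and>
    (\<forall>x c U. U \<subseteq> {1..n} \<longrightarrow> card U = r x \<longrightarrow>
       card {e\<in>A. \<tau> e = x \<and> colour_matches c (col e) \<and> f ` {h\<in>S. ed h = e} = U} \<in> {lo x c..hi x c}) \<and>
    (\<forall>c. \<forall>i\<in>{1..n}. card {h\<in>S. colour_matches c (col (ed h)) \<and> f h = i} \<in> {dlo c..dhi c}) \<and>
    (\<forall>j. n + card (w ` {h\<in>S. col (ed h) = j}) \<le> card {h\<in>S. col (ed h) = j} + 1 \<longrightarrow>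
       (\<forall>x\<in>{h\<in>S. col (ed h) = j}. \<forall>y\<in>{h\<in>S. col (ed h) = j}. (x, y) \<in> linked w f {h\<in>S. col (ed h) = j}))"
  using assms
proof (induction n arbitrary: S \<tau> w r lo hi)
  case 0
  have "S = {}"
  proof (rule equals0I)
    fix h assume h: "h \<in> S"
    then have "ed h \<in> A" using "0.prems" by blast
    then have "card {h'\<in>S. ed h' = ed h} = 0" using "0.prems"(4,5)[of "ed h"] by simp
    then show False using h "0.prems"(2) by auto
  qed
  \<comment> \<open>With no part left, \<open>U\<close> is empty and the binomial is 1, so the
    bounds on the type are already the claim.\<close>
  have "card {e\<in>A. \<tau> e = x \<and> colour_matches c (col e)} \<in> {lo x c..hi x c}" if "r x = 0" for x c
    using "0.prems"(7,8)[of x c] that by simp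
  then show ?case using \<open>S = {}\<close> by auto
next
  case (Suc n)
  note finA = Suc.prems(1) and finS = Suc.prems(2) and edS = Suc.prems(3) and r = Suc.prems(4)
    and rn = Suc.prems(5) and wc = Suc.prems(6) and lo = Suc.prems(7) and hi = Suc.prems(8)
    and dlo = Suc.prems(9) and dhi = Suc.prems(10)
  obtain Z where Z: "Z \<subseteq> S"
    and Zw: "\<And>v. Suc n * card {h\<in>Z. w h = v} < card {h\<in>S. w h = v} + Suc n"
    and Zq: "\<And>j. card {h\<in>S. 2 \<le> card {h'\<in>S. w h' = w h} \<and> col (ed h) = j} <
       Suc n * card {h\<in>Z. 2 \<le> card {h'\<in>S. w h' = w h} \<and> col (ed h) = j} + Suc n"
    and Zc: "\<And>c. Suc n * card {h\<in>Z. colour_matches c (col (ed h))} < card {h\<in>S. colour_matches c (col (ed h))} + Suc n"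
    "\<And>c. card {h\<in>S. colour_matches c (col (ed h))} < Suc n * card {h\<in>Z. colour_matches c (col (ed h))} + Suc n"
    and Ze: "\<And>e. Suc n * card {h\<in>Z. ed h = e} < card {h\<in>S. ed h = e} + Suc n"
    "\<And>e. card {h\<in>S. ed h = e} < Suc n * card {h\<in>Z. ed h = e} + Suc n"
    and Zt: "\<And>x c. Suc n * card {h\<in>Z. \<tau> (ed h) = x \<and> colour_matches c (col (ed h))}
       < card {h\<in>S. \<tau> (ed h) = x \<and> colour_matches c (col (ed h))} + Suc n"
    "\<And>x c. card {h\<in>S. \<tau> (ed h) = x \<and> colour_matches c (col (ed h))}
       < Suc n * card {h\<in>Z. \<tau> (ed h) = x \<and> colour_matches c (col (ed h))} + Suc n"
    by (rule fair_split[where S = S and w = w and col = col and ed = ed and N = "Suc n" and \<tau> = \<tau>, OF finS])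
      (rule wc that | assumption | simp)+
  define T where "T = ed ` Z"
  define \<tau>' where "\<tau>' e = 2 * \<tau> e + (if e \<in> T then 1 else 0)" for e
  define r' where "r' x = (if odd x then r (x div 2) - 1 else r (x div 2))" for x
  \<comment> \<open>An edge without hinges is never in \<open>T\<close>, so the odd type above such
    a type is empty. Truncated subtraction gives it \<open>r' = 0\<close> and binomial 1, hence its
    lower bound must be 0.\<close>
  define lo' where "lo' x c = (if odd x \<and> r (x div 2) = 0 then 0 else lo (x div 2) c)" for x c
  define hi' where "hi' x c = hi (x div 2) c" for x c
  \<comment> \<open>Within each color, all wings that \<open>Z\<close> meets are merged into the
    wing of one chosen hinge of \<open>Z\<close>. Choosing it per color keeps the wings
    monochromatic.\<close>
  define rep where "rep j = (SOME z. z \<in> Z \<and> col (ed z) = j)" for j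
  define w' where "w' h = (if \<exists>z\<in>Z. w z = w h then w (rep (col (ed h))) else w h)" for h
  define R where "R = S - Z"
  have finZ: "finite Z" using finS Z finite_subset by blast
  have TA: "T \<subseteq> A" using Z edS by (auto simp: T_def)
  have \<tau>'_iff: "\<tau>' e = 2 * x \<longleftrightarrow> \<tau> e = x \<and> e \<notin> T" "\<tau>' e = Suc (2 * x) \<longleftrightarrow> \<tau> e = x \<and> e \<in> T" for e x
    by (auto simp: \<tau>'_def) presburger+
  \<comment> \<open>An edge has at most \<open>Suc n\<close> hinges, so its fair share is at most
    one hinge; this keeps the parts of an edge distinct.\<close>
  have Ze1: "card {h\<in>Z. ed h = e} = (if e \<in> T then 1 else 0)" if e: "e \<in> A" for e
  proof (cases "e \<in> T")
    case True
    then have "{h\<in>Z. ed h = e} \<noteq> {}" by (auto simp: T_def)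
    then have "card {h\<in>Z. ed h = e} \<noteq> 0" using finZ by simp
    moreover have "card {h\<in>Z. ed h = e} < 2"
    proof (rule ccontr)
      assume "\<not> ?thesis"
      then have "Suc n * 2 \<le> Suc n * card {h\<in>Z. ed h = e}" by (intro mult_le_mono2) simp
      then show False using Ze(1)[of e] r[OF e] rn[OF e] by simp
    qed
    ultimately show ?thesis using True by simp
  next
    case False
    then have "{h\<in>Z. ed h = e} = {}" by (auto simp: T_def)
    then show ?thesis using False by (metis card.empty)
  qed
  have injZ: "inj_on ed Z"
  proof (rule inj_onI)
    fix x y assume xy: "x \<in> Z" "y \<in> Z" "ed x = ed y"
    then have "ed x \<in> A" using Z edS by blast
    from Ze1[OF this] have "card {h\<in>Z. ed h = ed x} \<le> Suc 0" by auto
    then show "x = y" using xy finZ by (auto simp: card_le_Suc0_iff_eq)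
  qed
  have cardR: "card {h\<in>R. p h} = card {h\<in>S. p h} - card {h\<in>Z. p h}" for p
  proof -
    have "{h\<in>R. p h} = {h\<in>S. p h} - {h\<in>Z. p h}" "{h\<in>Z. p h} \<subseteq> {h\<in>S. p h}" using Z by (auto simp: R_def)
    then show ?thesis using finZ by (simp add: card_Diff_subset)
  qed
  have cardT: "card {e\<in>T. p e} = card {h\<in>Z. p (ed h)}" for p
  proof -
    have "{e\<in>T. p e} = ed ` {h\<in>Z. p (ed h)}" by (auto simp: T_def)
    then show ?thesis using injZ by (metis (no_types, lifting) card_image inj_on_subset mem_Collect_eq subsetI)
  qed
  have r': "card {h\<in>R. ed h = e} = r' (\<tau>' e)" if e: "e \<in> A" for e
    using cardR[of "\<lambda>h. ed h = e"] Ze1[OF e] r[OF e] by (auto simp: r'_def \<tau>'_def)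
  have r'n: "r' (\<tau>' e) \<le> n" if e: "e \<in> A" for e
  proof (cases "e \<in> T")
    case True
    then show ?thesis using rn[OF e] by (simp add: r'_def \<tau>'_def)
  next
    case False
    \<comment> \<open>An edge with \<open>Suc n\<close> hinges must lose one, or \<open>n\<close>
      parts would be too few for the rest.\<close>
    then have "r (\<tau> e) < Suc n" using Ze(2)[of e] Ze1[OF e] r[OF e] by simp
    then show ?thesis using False by (simp add: r'_def \<tau>'_def)
  qed
  have wrep: "rep (col (ed h)) \<in> Z \<and> col (ed (rep (col (ed h)))) = col (ed h)" if h: "h \<in> S" "\<exists>z\<in>Z. w z = w h" for h
  proof -
    obtain z where "z \<in> Z" "w z = w h" using h by blast
    then have "z \<in> Z \<and> col (ed z) = col (ed h)" using wc[of z h] Z h by blast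
    then show ?thesis unfolding rep_def by (rule someI)
  qed
  have "\<exists>g. g \<in> S \<and> w' h = w g \<and> col (ed g) = col (ed h)" if "h \<in> S" for h
    using wrep[OF that] Z that unfolding w'_def by (cases "\<exists>z\<in>Z. w z = w h") auto
  then have w'c: "col (ed h) = col (ed h')" if "h \<in> R" "h' \<in> R" "w' h = w' h'" for h h'
    using that wc unfolding R_def by (metis DiffD1)
  let ?m = "\<lambda>x c. card {e\<in>A. \<tau> e = x \<and> colour_matches c (col e)}"
  let ?z = "\<lambda>x c. card {h\<in>Z. \<tau> (ed h) = x \<and> colour_matches c (col (ed h))}"
  have mr: "card {h\<in>S. \<tau> (ed h) = x \<and> colour_matches c (col (ed h))} = ?m x c * r x" for x c
    using r by (intro card_fibres_uniform[OF finS finA edS, of "\<lambda>e. \<tau> e = x \<and> colour_matches c (col e)"]) auto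
  have z: "card {e\<in>T. \<tau> e = x \<and> colour_matches c (col e)} = ?z x c" for x c by (rule cardT)
  have odd: "card {e\<in>A. \<tau>' e = Suc (2 * x) \<and> colour_matches c (col e)} = ?z x c" for x c
    unfolding \<tau>'_iff z[symmetric] using TA by (intro arg_cong[where f=card]) auto
  have even: "card {e\<in>A. \<tau>' e = 2 * x \<and> colour_matches c (col e)} = ?m x c - ?z x c" for x c
  proof -
    have "{e\<in>A. \<tau>' e = 2 * x \<and> colour_matches c (col e)}
      = {e\<in>A. \<tau> e = x \<and> colour_matches c (col e)} - {e\<in>T. \<tau> e = x \<and> colour_matches c (col e)}"
      unfolding \<tau>'_iff by auto
    moreover have "{e\<in>T. \<tau> e = x \<and> colour_matches c (col e)} \<subseteq> {e\<in>A. \<tau> e = x \<and> colour_matches c (col e)}"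
      using TA by auto
    ultimately show ?thesis using finA z by (simp add: card_Diff_subset finite_subset)
  qed
  note type_bounds = fair_type_bounds[OF lo hi Zt(1)[unfolded mr] Zt(2)[unfolded mr]]
  have types: "lo' x c * (n choose r' x) \<le> card {e\<in>A. \<tau>' e = x \<and> colour_matches c (col e)} \<and>
     card {e\<in>A. \<tau>' e = x \<and> colour_matches c (col e)} \<le> hi' x c * (n choose r' x)" for x c
  proof (cases "odd x")
    case True
    then obtain y where y: "x = Suc (2 * y)" by (metis oddE Suc_eq_plus1)
    show ?thesis
    proof (cases "r y = 0")
      case True
      then have "Suc n * ?z y c < Suc n * 1" using Zt(1)[of y c, unfolded mr] by simp
      then have "?z y c = 0" by (simp only: mult_less_cancel1 less_one)
      then show ?thesis using True odd[of y c] by (simp add: y lo'_def)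
    next
      case False
      then show ?thesis using type_bounds(1,2)[of y c] odd[of y c] by (simp add: y lo'_def hi'_def r'_def)
    qed
  next
    case False
    then obtain y where y: "x = 2 * y" by (metis evenE)
    show ?thesis
    proof (cases "r y \<le> Suc n")
      case True
      then show ?thesis using type_bounds(3,4)[of y c] even[of y c] by (simp add: y lo'_def hi'_def r'_def)
    next
      case False
      \<comment> \<open>No edge has this type: its upper bound is a multiple of a vanishing
        binomial.\<close>
      then have choose: "Suc n choose r y = 0" "n choose r y = 0" by (auto intro: binomial_eq_0)
      then have "?m y c = 0" using hi[of y c] by (simp only: mult_0_right le_zero_eq)
      then show ?thesis using choose even[of y c] by (simp add: y lo'_def hi'_def r'_def)
    qed
  qed
  note deg_bounds = fair_degree_bounds[OF dlo dhi Zc]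
  have degs: "dlo c * n \<le> card {h\<in>R. colour_matches c (col (ed h))} \<and>
     card {h\<in>R. colour_matches c (col (ed h))} \<le> dhi c * n" for c
    using deg_bounds(3,4)[of c] cardR by simp
  have "finite R" "ed ` R \<subseteq> A" using finS edS by (auto simp: R_def)
  obtain f' where f': "f' ` R \<subseteq> {1..n}" and inj: "\<forall>e\<in>A. inj_on f' {h\<in>R. ed h = e}"
    and ty: "\<forall>x c U. U \<subseteq> {1..n} \<longrightarrow> card U = r' x \<longrightarrow>
       card {e\<in>A. \<tau>' e = x \<and> colour_matches c (col e) \<and> f' ` {h\<in>R. ed h = e} = U} \<in> {lo' x c..hi' x c}"
    and dg: "\<forall>c. \<forall>i\<in>{1..n}. card {h\<in>R. colour_matches c (col (ed h)) \<and> f' h = i} \<in> {dlo c..dhi c}"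
    and conn: "\<forall>j. n + card (w' ` {h\<in>R. col (ed h) = j}) \<le> card {h\<in>R. col (ed h) = j} + 1 \<longrightarrow>
       (\<forall>x\<in>{h\<in>R. col (ed h) = j}. \<forall>y\<in>{h\<in>R. col (ed h) = j}. (x, y) \<in> linked w' f' {h\<in>R. col (ed h) = j})"
    by (rule exE[OF Suc.IH[where w = w' and r = r' and \<tau> = \<tau>' and lo = lo' and hi = hi', OF finA \<open>finite R\<close> \<open>ed ` R \<subseteq> A\<close>]])
      (rule r', assumption | rule r'n, assumption | rule w'c, assumption+ | rule conjunct1[OF types] conjunct2[OF types] conjunct1[OF degs] conjunct2[OF degs]
        | elim conjE, rule that, assumption+)+
  define f where "f h = (if h \<in> Z then Suc n else f' h)" for h
  have fle: "f' h \<in> {1..n}" if "h \<in> S" "h \<notin> Z" for h using f' that by (auto simp: R_def)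
  have fN: "f h = Suc n \<longleftrightarrow> h \<in> Z" if "h \<in> S" for h using fle[OF that] by (auto simp: f_def)
  have range: "f ` S \<subseteq> {1..Suc n}" using fle by (fastforce simp: f_def)
  have injf: "inj_on f {h\<in>S. ed h = e}" if e: "e \<in> A" for e
  proof (rule inj_onI)
    fix x y assume x: "x \<in> {h\<in>S. ed h = e}" and y: "y \<in> {h\<in>S. ed h = e}" and eq: "f x = f y"
    then have "x \<in> Z \<longleftrightarrow> y \<in> Z" using fN by (metis (no_types, lifting) mem_Collect_eq)
    show "x = y"
    proof (cases "x \<in> Z")
      case True
      then show ?thesis using injZ x y \<open>x \<in> Z \<longleftrightarrow> y \<in> Z\<close> by (auto dest: inj_onD)
    next
      case False
      then have "x \<in> {h\<in>R. ed h = e}" "y \<in> {h\<in>R. ed h = e}" "f' x = f' y"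
        using x y eq \<open>x \<in> Z \<longleftrightarrow> y \<in> Z\<close> by (auto simp: R_def f_def)
      then show ?thesis using inj e by (auto dest: inj_onD)
    qed
  qed
  have img: "f ` {h\<in>S. ed h = e} = f' ` {h\<in>R. ed h = e} \<union> (if e \<in> T then {Suc n} else {})" for e
  proof -
    have "{h\<in>S. ed h = e} = {h\<in>R. ed h = e} \<union> {h\<in>Z. ed h = e}" using Z by (auto simp: R_def)
    moreover have "f ` {h\<in>R. ed h = e} = f' ` {h\<in>R. ed h = e}" by (rule image_cong) (auto simp: R_def f_def)
    moreover have "f ` {h\<in>Z. ed h = e} = (if e \<in> T then {Suc n} else {})" by (auto simp: f_def T_def)
    ultimately show ?thesis by (simp add: image_Un)
  qed
  have notin: "Suc n \<notin> f' ` {h\<in>R. ed h = e}" for e using f' by fastforce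
  have types_f: "card {e\<in>A. \<tau> e = x \<and> colour_matches c (col e) \<and> f ` {h\<in>S. ed h = e} = U} \<in> {lo x c..hi x c}"
    if U: "U \<subseteq> {1..Suc n}" "card U = r x" for x c U
  proof (cases "Suc n \<in> U")
    case True
    have finU: "finite U" using U(1) finite_subset by blast
    have "r x \<noteq> 0" using True finU U(2) by (metis card_0_eq empty_iff)
    \<comment> \<open>An edge meets the part \<open>Suc n\<close> exactly when it is in
      \<open>T\<close>, so prescribing \<open>U\<close> means prescribing the refined type and the
      remaining parts.\<close>
    have "f ` {h\<in>S. ed h = e} = U \<longleftrightarrow> e \<in> T \<and> f' ` {h\<in>R. ed h = e} = U - {Suc n}" for e
      unfolding img using notin[of e] True by (simp split: if_split) blast
    then have eq: "{e\<in>A. \<tau> e = x \<and> colour_matches c (col e) \<and> f ` {h\<in>S. ed h = e} = U}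
      = {e\<in>A. \<tau>' e = Suc (2 * x) \<and> colour_matches c (col e) \<and> f' ` {h\<in>R. ed h = e} = U - {Suc n}}"
      unfolding \<tau>'_iff by auto
    have "U - {Suc n} \<subseteq> {1..n}" using U(1) by (auto simp: le_Suc_eq)
    moreover have "card (U - {Suc n}) = r' (Suc (2 * x))" using U True finU by (simp add: r'_def)
    ultimately have "card {e\<in>A. \<tau>' e = Suc (2 * x) \<and> colour_matches c (col e) \<and> f' ` {h\<in>R. ed h = e} = U - {Suc n}}
       \<in> {lo' (Suc (2 * x)) c..hi' (Suc (2 * x)) c}" using ty by blast
    then show ?thesis unfolding eq using \<open>r x \<noteq> 0\<close> by (simp add: lo'_def hi'_def)
  next
    case False
    have "f ` {h\<in>S. ed h = e} = U \<longleftrightarrow> e \<notin> T \<and> f' ` {h\<in>R. ed h = e} = U" for e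
      unfolding img using notin[of e] False by (cases "e \<in> T") auto
    then have eq: "{e\<in>A. \<tau> e = x \<and> colour_matches c (col e) \<and> f ` {h\<in>S. ed h = e} = U}
      = {e\<in>A. \<tau>' e = 2 * x \<and> colour_matches c (col e) \<and> f' ` {h\<in>R. ed h = e} = U}"
      unfolding \<tau>'_iff by auto
    have "U \<subseteq> {1..n}" using U(1) False by (force simp: le_Suc_eq)
    moreover have "card U = r' (2 * x)" using U by (simp add: r'_def)
    ultimately have "card {e\<in>A. \<tau>' e = 2 * x \<and> colour_matches c (col e) \<and> f' ` {h\<in>R. ed h = e} = U}
       \<in> {lo' (2 * x) c..hi' (2 * x) c}" using ty by blast
    then show ?thesis unfolding eq by (simp add: lo'_def hi'_def)
  qed
  have degs_f: "card {h\<in>S. colour_matches c (col (ed h)) \<and> f h = i} \<in> {dlo c..dhi c}" if i: "i \<in> {1..Suc n}" for c i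
  proof (cases "i = Suc n")
    case True
    then have "{h\<in>S. colour_matches c (col (ed h)) \<and> f h = i} = {h\<in>Z. colour_matches c (col (ed h))}"
      using fN Z by auto
    then show ?thesis using deg_bounds(1,2)[of c] by simp
  next
    case False
    then have "{h\<in>S. colour_matches c (col (ed h)) \<and> f h = i} = {h\<in>R. colour_matches c (col (ed h)) \<and> f' h = i}"
      by (auto simp: f_def R_def)
    then show ?thesis using dg i False by auto
  qed
  have conn_f: "(x, y) \<in> linked w f {h\<in>S. col (ed h) = j}"
    if enough: "Suc n + card (w ` {h\<in>S. col (ed h) = j}) \<le> card {h\<in>S. col (ed h) = j} + 1"
      and x: "x \<in> {h\<in>S. col (ed h) = j}" and y: "y \<in> {h\<in>S. col (ed h) = j}" for j x y
  \<comment> \<open>\<open>fair_subset_wings\<close> needs two parts; with one part all hinges share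
    it.\<close>
  proof (cases "n = 0")
    case True
    have "z \<in> Z" if "z \<in> S" for z
      using fle[OF that] True by force
    then show ?thesis using x y by (intro linked_step) (auto simp: f_def)
  next
    case False
    let ?S = "{h\<in>S. col (ed h) = j}" and ?Z = "{h\<in>Z. col (ed h) = j}"
    \<comment> \<open>Wings are monochromatic, so counts within the color \<open>j\<close> agree
      with counts over all of \<open>S\<close>.\<close>
    have same: "{h\<in>?S. w h = v} = {h\<in>S. w h = v}" "{h\<in>?Z. w h = v} = {h\<in>Z. w h = v}" if "v \<in> w ` ?S" for v
      using that wc Z by blast+
    have d: "{h\<in>?S. 2 \<le> card {h'\<in>?S. w h' = w h}} = {h\<in>S. 2 \<le> card {h'\<in>S. w h' = w h} \<and> col (ed h) = j}"
      "{h\<in>?Z. 2 \<le> card {h'\<in>?S. w h' = w h}} = {h\<in>Z. 2 \<le> card {h'\<in>S. w h' = w h} \<and> col (ed h) = j}"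
      using same(1) Z by auto
    have fw: "Suc n * card {h\<in>?Z. w h = v} < card {h\<in>?S. w h = v} + Suc n" for v
    proof (cases "v \<in> w ` ?S")
      case True
      then show ?thesis using same Zw by simp
    next
      case False
      then have "{h\<in>?Z. w h = v} = {}" using Z by blast
      then show ?thesis by (simp only: card.empty)
    qed
    have S2: "finite ?S" "?Z \<subseteq> ?S" "2 \<le> Suc n" using finS Z False by auto
    note wings = fair_subset_wings[OF S2 enough fw, unfolded d, OF Zq]
    from wings(1) obtain a z where az: "a \<in> ?S - ?Z" "z \<in> ?Z" "w a = w z" by blast
    have RR: "{h\<in>R. col (ed h) = j} = ?S - ?Z" by (auto simp: R_def)
    have w'j: "w' x = (if w x \<in> w ` ?Z then w (rep j) else w x)" if "x \<in> ?S" for x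
    proof -
      have "(\<exists>z\<in>Z. w z = w x) \<longleftrightarrow> w x \<in> w ` ?Z"
      proof
        assume "\<exists>z\<in>Z. w z = w x"
        then obtain z where z: "z \<in> Z" "w z = w x" by blast
        then have "col (ed z) = j" using wc[of z x] that Z by auto
        with z show "w x \<in> w ` ?Z" by (intro image_eqI[of _ _ z]) auto
      qed auto
      then show ?thesis using that by (simp add: w'_def)
    qed
    have rep: "rep j \<in> ?Z" using wrep[of z] az Z by auto
    \<comment> \<open>All wings met by \<open>?Z\<close> become the one wing
      \<open>w (rep j)\<close>; by \<open>wings(2)\<close> the loss of hinges is then small enough
      for the inequality with \<open>n\<close> parts.\<close>
    have "w' ` (?S - ?Z) \<subseteq> insert (w (rep j)) (w ` ?S - w ` ?Z)" using w'j by auto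
    then have "card (w' ` (?S - ?Z)) \<le> card (insert (w (rep j)) (w ` ?S - w ` ?Z))"
      using S2(1) by (intro card_mono) auto
    also have "\<dots> \<le> card (w ` ?S - w ` ?Z) + 1" using S2(1) by (simp add: card_insert_if)
    also have "card (w ` ?S - w ` ?Z) = card (w ` ?S) - card (w ` ?Z)"
      using S2 finite_subset[OF S2(2,1)] by (intro card_Diff_subset) auto
    finally have "card (w' ` (?S - ?Z)) \<le> card (w ` ?S) - card (w ` ?Z) + 1" .
    moreover have "card (w ` ?Z) \<le> card (w ` ?S)" "card ?Z \<le> card ?S" using S2 by (auto intro!: card_mono)
    moreover have "card (?S - ?Z) = card ?S - card ?Z" using S2 finite_subset[OF S2(2,1)] by (intro card_Diff_subset) auto
    ultimately have "n + card (w' ` (?S - ?Z)) \<le> card (?S - ?Z) + 1" using wings(2) by linarith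
    then have "\<And>x y. x \<in> ?S - ?Z \<Longrightarrow> y \<in> ?S - ?Z \<Longrightarrow> (x, y) \<in> linked w' f' (?S - ?Z)"
      using conn RR by (metis (no_types, lifting))
    then show ?thesis
      by (intro linked_merge[OF S2(2) rep w'j _ _ az _ x y, where f' = f' and N = "Suc n"]) (auto simp: f_def)
  qed
  show ?case
    by (intro exI[of _ f] conjI ballI allI impI) (rule range | rule injf types_f degs_f conn_f, assumption+)+
qed

section \<open>Wings and components\<close>

text \<open>The \<open>\<alpha>\<close>-wings correspond to the classes of \<open>edge_link\<close> that contain an edge incident with \<open>\<alpha>\<close>.\<close>

definition edge_link :: "('a, 'e) hypergraph \<Rightarrow> 'a \<Rightarrow> ('e \<times> 'e) set" where
  "edge_link G \<alpha> = {(e, e'). e \<in> hedges G \<and> e' \<in> hedges G \<and>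
     (\<exists>v. v \<noteq> \<alpha> \<and> v \<in># hends G e \<and> v \<in># hends G e')}\<^sup>*"

definition wing_edges :: "('a, 'e) hypergraph \<Rightarrow> 'a \<Rightarrow> 'e \<Rightarrow> 'e set" where
  "wing_edges G \<alpha> e = edge_link G \<alpha> `` {e}"

lemma edge_link_refl: "(e, e) \<in> edge_link G \<alpha>"
  by (simp add: edge_link_def)

lemma edge_link_trans: "(a, b) \<in> edge_link G \<alpha> \<Longrightarrow> (b, c) \<in> edge_link G \<alpha> \<Longrightarrow> (a, c) \<in> edge_link G \<alpha>"
  unfolding edge_link_def by (rule rtrancl_trans)

lemma edge_link_sym: "(a, b) \<in> edge_link G \<alpha> \<Longrightarrow> (b, a) \<in> edge_link G \<alpha>"
  unfolding edge_link_def by (erule symD[OF sym_rtrancl, rotated]) (auto simp: sym_def)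

lemma edge_link_step:
  "\<lbrakk>e \<in> hedges G; e' \<in> hedges G; v \<noteq> \<alpha>; v \<in># hends G e; v \<in># hends G e'\<rbrakk> \<Longrightarrow> (e, e') \<in> edge_link G \<alpha>"
  unfolding edge_link_def by (rule r_into_rtrancl) blast

lemma edge_link_closed:
  assumes "(e, e') \<in> edge_link G \<alpha>" "e \<in> D"
    and "\<And>d d' v. \<lbrakk>d \<in> D; d \<in> hedges G; d' \<in> hedges G; v \<noteq> \<alpha>; v \<in># hends G d; v \<in># hends G d'; (e, d') \<in> edge_link G \<alpha>\<rbrakk> \<Longrightarrow> d' \<in> D"
  shows "e' \<in> D"
  using assms(1) unfolding edge_link_def
proof (induction rule: rtrancl_induct)
  case base
  show ?case by (rule assms(2))
next
  case (step y z)
  then obtain v where "y \<in> hedges G" "z \<in> hedges G" "v \<noteq> \<alpha>" "v \<in># hends G y" "v \<in># hends G z" by blast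
  moreover from this have "(e, z) \<in> edge_link G \<alpha>"
    using step.hyps(1) edge_link_step edge_link_trans unfolding edge_link_def[symmetric] by metis
  ultimately show ?case using assms(3) step.IH by blast
qed

lemma wing_edges_subset:
  assumes "e \<in> hedges G"
  shows "wing_edges G \<alpha> e \<subseteq> hedges G"
proof
  fix e' assume "e' \<in> wing_edges G \<alpha> e"
  then have "(e, e') \<in> edge_link G \<alpha>" by (simp add: wing_edges_def)
  then show "e' \<in> hedges G" using assms by (rule edge_link_closed)
qed

lemma wing_edges_eq_iff: "wing_edges G \<alpha> e = wing_edges G \<alpha> e' \<longleftrightarrow> (e, e') \<in> edge_link G \<alpha>"
proof
  assume "wing_edges G \<alpha> e = wing_edges G \<alpha> e'"
  moreover have "e' \<in> wing_edges G \<alpha> e'" by (simp add: wing_edges_def edge_link_refl)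
  ultimately have "e' \<in> wing_edges G \<alpha> e" by simp
  then show "(e, e') \<in> edge_link G \<alpha>" by (simp add: wing_edges_def)
next
  assume "(e, e') \<in> edge_link G \<alpha>"
  from edge_link_trans[OF this] edge_link_trans[OF edge_link_sym[OF this]]
  show "wing_edges G \<alpha> e = wing_edges G \<alpha> e'" unfolding wing_edges_def by auto
qed

section \<open>The sub-hypergraphs that are wings\<close>

definition wing_of :: "('a, 'e) hypergraph \<Rightarrow> 'a \<Rightarrow> 'e set \<Rightarrow> ('a, 'e) hypergraph" where
  "wing_of G \<alpha> D = \<lparr>hverts = insert \<alpha> (\<Union>e\<in>D. set_mset (hends G e)), hedges = D, hends = hends G\<rparr>"

lemma wing_of_sel [simp]:
  "hverts (wing_of G \<alpha> D) = insert \<alpha> (\<Union>e\<in>D. set_mset (hends G e))"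
  "hedges (wing_of G \<alpha> D) = D" "hends (wing_of G \<alpha> D) = hends G"
  by (simp_all add: wing_of_def)

lemma sym_hg_adj: "sym (hg_adj G)"
  by (auto simp: hg_adj_def sym_def)

lemma hg_reach_sym: "(x, y) \<in> hg_reach G \<Longrightarrow> (y, x) \<in> hg_reach G"
  using symD[OF sym_rtrancl[OF sym_hg_adj], of x y G] by (simp add: hg_reach_def)

lemma hg_reach_trans: "(x, y) \<in> hg_reach G \<Longrightarrow> (y, z) \<in> hg_reach G \<Longrightarrow> (x, z) \<in> hg_reach G"
  unfolding hg_reach_def by auto

lemma equiv_hg_reach: "equiv (hverts G) (hg_reach G)"
proof (rule equivI)
  show "hg_reach G \<subseteq> hverts G \<times> hverts G" by (auto simp: hg_reach_def)
  show "refl_on (hverts G) (hg_reach G)" by (auto simp: hg_reach_def refl_on_def)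
  show "sym (hg_reach G)" by (rule symI) (rule hg_reach_sym)
  show "trans (hg_reach G)" by (rule transI) (rule hg_reach_trans)
qed

lemma hypergraph_ends_subset: "hypergraph G \<Longrightarrow> e \<in> hedges G \<Longrightarrow> v \<in># hends G e \<Longrightarrow> v \<in> hverts G"
  unfolding hypergraph_def by blast

lemma sub_hypergraph_wing_of:
  assumes "hypergraph G" "\<alpha> \<in> hverts G" "D \<subseteq> hedges G"
  shows "sub_hypergraph (wing_of G \<alpha> D) G"
proof -
  have "finite D" using assms finite_subset by (auto simp: hypergraph_def)
  then show ?thesis using assms unfolding sub_hypergraph_def hypergraph_def by (auto simp: subset_iff)
qed

text \<open>Every vertex of the class is reached from \<alpha> along a chain of edges starting at
  \<open>e\<close>. \<alpha> does not cut the class, because consecutive edges of a chain share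
  another vertex, while the two sides of a cut have only \<alpha> in common.\<close>

lemma hg_wing_wing_of:
  assumes G: "hypergraph G" "\<alpha> \<in> hverts G" and e: "e \<in> hedges G" "\<alpha> \<in># hends G e"
  shows "hg_wing G \<alpha> (wing_of G \<alpha> (wing_edges G \<alpha> e))"
proof -
  let ?D = "wing_edges G \<alpha> e"
  let ?W = "wing_of G \<alpha> ?D"
  have DG: "?D \<subseteq> hedges G" using wing_edges_subset e(1) .
  have eD: "e \<in> ?D" by (simp add: wing_edges_def edge_link_refl)
  have D_closed: "d' \<in> ?D" if "d \<in> ?D" "d' \<in> hedges G" "v \<noteq> \<alpha>" "v \<in># hends G d" "v \<in># hends G d'" for d d' v
  proof -
    have "(e, d) \<in> edge_link G \<alpha>" "(d, d') \<in> edge_link G \<alpha>"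
      using that DG by (auto simp: wing_edges_def intro: edge_link_step)
    then have "(e, d') \<in> edge_link G \<alpha>" by (rule edge_link_trans)
    then show ?thesis by (simp add: wing_edges_def)
  qed
  have reach: "(\<alpha>, v) \<in> (hg_adj ?W)\<^sup>*" if d: "d \<in> ?D" and v: "v \<in># hends G d" for d v
  proof -
    have "d \<in> {d \<in> ?D. \<forall>v. v \<in># hends G d \<longrightarrow> (\<alpha>, v) \<in> (hg_adj ?W)\<^sup>*}"
    proof (rule edge_link_closed)
      show "(e, d) \<in> edge_link G \<alpha>" using d by (simp add: wing_edges_def)
      show "e \<in> {d \<in> ?D. \<forall>v. v \<in># hends G d \<longrightarrow> (\<alpha>, v) \<in> (hg_adj ?W)\<^sup>*}"
        using eD e(2) by (auto simp: hg_adj_def intro!: r_into_rtrancl)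
    next
      fix a b u
      assume a: "a \<in> {d \<in> ?D. \<forall>v. v \<in># hends G d \<longrightarrow> (\<alpha>, v) \<in> (hg_adj ?W)\<^sup>*}"
        and u: "b \<in> hedges G" "u \<noteq> \<alpha>" "u \<in># hends G a" "u \<in># hends G b"
      have b: "b \<in> ?D" using D_closed a u by blast
      have "(\<alpha>, v) \<in> (hg_adj ?W)\<^sup>*" if "v \<in># hends G b" for v
      proof -
        have "(\<alpha>, u) \<in> (hg_adj ?W)\<^sup>*" using a u by blast
        moreover have "(u, v) \<in> hg_adj ?W" using b u that by (auto simp: hg_adj_def)
        ultimately show ?thesis by (rule rtrancl_into_rtrancl)
      qed
      then show "b \<in> {d \<in> ?D. \<forall>v. v \<in># hends G d \<longrightarrow> (\<alpha>, v) \<in> (hg_adj ?W)\<^sup>*}" using b by blast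
    qed
    then show ?thesis using v by blast
  qed
  have reach': "(\<alpha>, v) \<in> hg_reach ?W" if "v \<in> hverts ?W" for v
    using that reach by (auto simp: hg_reach_def)
  have conn: "hg_connected ?W"
    unfolding hg_connected_def
  proof (intro conjI ballI)
    fix u v assume uv: "u \<in> hverts ?W" "v \<in> hverts ?W"
    show "(u, v) \<in> hg_reach ?W" by (rule hg_reach_trans[OF hg_reach_sym[OF reach'[OF uv(1)]] reach'[OF uv(2)]])
  qed simp
  have "\<not> hg_cut_vertex ?W \<alpha>"
  proof
    assume "hg_cut_vertex ?W \<alpha>"
    then obtain I J where IJ: "sub_hypergraph I ?W" "sub_hypergraph J ?W" "hedges I \<noteq> {}" "hedges J \<noteq> {}"
      "hedges I \<union> hedges J = ?D" "hverts I \<inter> hverts J = {\<alpha>}" "hedges I \<inter> hedges J = {}"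
      unfolding hg_cut_vertex_def hg_nontrivial_def by auto
    have ends: "v \<in> hverts I" if "d \<in> hedges I" "v \<in># hends G d" for d v
      using IJ(1) that hypergraph_ends_subset[of I d v] by (auto simp: sub_hypergraph_def)
    have ends': "v \<in> hverts J" if "d \<in> hedges J" "v \<in># hends G d" for d v
      using IJ(2) that hypergraph_ends_subset[of J d v] by (auto simp: sub_hypergraph_def)
    obtain a b where ab: "a \<in> hedges I" "b \<in> hedges J" using IJ(3,4) by blast
    then have "a \<in> ?D" "b \<in> ?D" using IJ(5) by auto
    then have ab_link: "(a, b) \<in> edge_link G \<alpha>"
      using edge_link_trans[OF edge_link_sym, of e a G \<alpha> b] by (simp add: wing_edges_def)
    have "b \<in> hedges I"
    proof (rule edge_link_closed[OF ab_link ab(1)])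
      fix d d' v assume d: "d \<in> hedges I" "d' \<in> hedges G" "v \<noteq> \<alpha>" "v \<in># hends G d" "v \<in># hends G d'"
      then have "d' \<in> ?D" using D_closed IJ(5) by blast
      moreover have "d' \<notin> hedges J" using ends[OF d(1,4)] ends'[of d', OF _ d(5)] IJ(6) d(3) by blast
      ultimately show "d' \<in> hedges I" using IJ(5) by blast
    qed
    then show False using ab IJ(7) by blast
  qed
  moreover have "v \<notin># hends G d" if "d \<in> hedges G - ?D" "v \<in> hverts ?W - {\<alpha>}" for d v
    using that D_closed by auto
  ultimately show ?thesis
    unfolding hg_wing_def hg_nontrivial_def using sub_hypergraph_wing_of[OF G DG] conn eD by auto
qed

text \<open>Connectivity puts \<alpha> on some edge of \<open>W\<close>, whose class stays inside
  \<open>W\<close> because outer edges meet \<open>W\<close> at most in \<alpha>. Were the class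
  smaller than \<open>W\<close>, it and the remaining edges would show \<alpha> to be a cut
  vertex.\<close>

lemma hg_wing_imp_wing_of:
  assumes G: "hypergraph G" and W: "hg_wing G \<alpha> W"
  shows "\<exists>e\<in>hedges G. \<alpha> \<in># hends G e \<and> W = wing_of G \<alpha> (wing_edges G \<alpha> e)"
proof -
  let ?D = "hedges W"
  have WG: "hypergraph W" "hverts W \<subseteq> hverts G" "?D \<subseteq> hedges G" "hends W = hends G"
    and \<alpha>W: "\<alpha> \<in> hverts W" and nontriv: "?D \<noteq> {}" and conn: "hg_connected W" and cut: "\<not> hg_cut_vertex W \<alpha>"
    and outside: "\<And>e v. e \<in> hedges G - ?D \<Longrightarrow> v \<in> hverts W - {\<alpha>} \<Longrightarrow> v \<notin># hends G e"
    using W unfolding hg_wing_def sub_hypergraph_def hg_nontrivial_def by auto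
  have endsW: "v \<in> hverts W" if "d \<in> ?D" "v \<in># hends G d" for d v
    using that WG hypergraph_ends_subset[of W d v] by simp
  have reach: "(u, v) \<in> (hg_adj W)\<^sup>*" if "u \<in> hverts W" "v \<in> hverts W" for u v
    using conn that unfolding hg_connected_def hg_reach_def by auto
  have first: "\<exists>d\<in>?D. u \<in># hends G d" if "(u, v) \<in> (hg_adj W)\<^sup>*" "u \<noteq> v" for u v
    using that WG(4) by (cases rule: converse_rtranclE) (auto simp: hg_adj_def)
  have "\<exists>e\<in>?D. \<alpha> \<in># hends G e"
  proof -
    obtain d where d: "d \<in> ?D" using nontriv by blast
    then have "hends G d \<noteq> {#}" using WG G unfolding hypergraph_def by auto
    then obtain u where u: "u \<in># hends G d" by blast
    show ?thesis
    proof (cases "u = \<alpha>")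
      case False
      then show ?thesis using first reach[OF \<alpha>W endsW[OF d u]] by blast
    qed (use d u in blast)
  qed
  then obtain e where e: "e \<in> ?D" "\<alpha> \<in># hends G e" by blast
  let ?C = "wing_edges G \<alpha> e"
  have eG: "e \<in> hedges G" using e WG by blast
  \<comment> \<open>Connectivity excludes isolated vertices other than \<alpha>, so \<open>W\<close>
    is determined by its edges.\<close>
  have verts: "hverts W = insert \<alpha> (\<Union>d\<in>?D. set_mset (hends G d))"
  proof (intro equalityI subsetI)
    fix v assume v: "v \<in> hverts W"
    show "v \<in> insert \<alpha> (\<Union>d\<in>?D. set_mset (hends G d))"
      using first[OF reach[OF v \<alpha>W]] by (cases "v = \<alpha>") auto
  qed (use \<alpha>W endsW in auto)
  then have W_eq: "W = wing_of G \<alpha> ?D" using WG(4) by (cases W) (simp add: wing_of_def)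
  have CD: "?C \<subseteq> ?D"
  proof
    fix d assume "d \<in> ?C"
    then have "(e, d) \<in> edge_link G \<alpha>" by (simp add: wing_edges_def)
    then show "d \<in> ?D"
    proof (rule edge_link_closed[OF _ e(1)])
      fix a b v assume "a \<in> ?D" "b \<in> hedges G" "v \<noteq> \<alpha>" "v \<in># hends G a" "v \<in># hends G b"
      then show "b \<in> ?D" using outside endsW by blast
    qed
  qed
  have "?C = ?D"
  proof (rule ccontr)
    assume ne: "?C \<noteq> ?D"
    let ?I = "wing_of W \<alpha> ?C" and ?J = "wing_of W \<alpha> (?D - ?C)"
    have disj: "v = \<alpha>" if v: "a \<in> ?C" "b \<in> ?D - ?C" "v \<in># hends G a" "v \<in># hends G b" for a b v
    proof (rule ccontr)
      assume "v \<noteq> \<alpha>"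
      then have "(a, b) \<in> edge_link G \<alpha>" using edge_link_step[of a G b v \<alpha>] v WG(3) CD by blast
      then have "b \<in> ?C" using v(1) edge_link_trans[of e a G \<alpha> b] by (simp add: wing_edges_def)
      then show False using v(2) by blast
    qed
    have "hverts ?I \<inter> hverts ?J = {\<alpha>}"
    proof (intro equalityI subsetI)
      fix v assume "v \<in> hverts ?I \<inter> hverts ?J"
      then show "v \<in> {\<alpha>}" using disj WG(4) by auto
    qed simp
    moreover have "hverts ?I \<union> hverts ?J = hverts W" using CD WG(4) unfolding verts by auto
    moreover have "e \<in> ?C" by (simp add: wing_edges_def edge_link_refl)
    moreover have "?D - ?C \<noteq> {}" using ne CD by blast
    moreover have "sub_hypergraph ?I W" "sub_hypergraph ?J W"
      using CD by (auto intro!: sub_hypergraph_wing_of[OF WG(1) \<alpha>W])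
    moreover have "hedges ?I \<union> hedges ?J = hedges W" "hedges ?I \<inter> hedges ?J = {}" using CD by auto
    ultimately have "hg_cut_vertex W \<alpha>"
      unfolding hg_cut_vertex_def hg_nontrivial_def using conn \<alpha>W
      by - (rule conjI, assumption, rule conjI, assumption, rule exI[of _ ?I], rule exI[of _ ?J],
          auto simp del: wing_of_sel(1))
    with cut show False by blast
  qed
  then show ?thesis using W_eq e eG by metis
qed

lemma hg_num_wings_eq:
  assumes "hypergraph G" "\<alpha> \<in> hverts G"
  shows "hg_num_wings G \<alpha> = card (wing_edges G \<alpha> ` {e \<in> hedges G. \<alpha> \<in># hends G e})"
proof -
  have "{W. hg_wing G \<alpha> W} = wing_of G \<alpha> ` wing_edges G \<alpha> ` {e \<in> hedges G. \<alpha> \<in># hends G e}"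
  proof (intro equalityI subsetI)
    fix W assume "W \<in> {W. hg_wing G \<alpha> W}"
    then show "W \<in> wing_of G \<alpha> ` wing_edges G \<alpha> ` {e \<in> hedges G. \<alpha> \<in># hends G e}"
      using hg_wing_imp_wing_of[OF assms(1), of \<alpha> W] by auto
  qed (use hg_wing_wing_of[OF assms] in auto)
  moreover have "inj_on (wing_of G \<alpha>) A" for A
    by (rule inj_onI) (drule arg_cong[of _ _ hedges], simp)
  ultimately show ?thesis by (simp add: hg_num_wings_def card_image)
qed

section \<open>Components of a hypergraph and of its detachment\<close>

text \<open>\<open>g\<close> factors through \<open>f\<close> by a surjection \<open>h\<close> of
  finite images, so equal sizes mean that \<open>h\<close> is injective. Later \<open>f\<close> and
  \<open>g\<close> send a vertex to its component in the detachment and in the original.\<close>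

lemma card_image_eq_iff_factor:
  assumes "finite A" and factor: "\<And>x y. x \<in> A \<Longrightarrow> y \<in> A \<Longrightarrow> f x = f y \<Longrightarrow> g x = g y"
  shows "card (f ` A) = card (g ` A) \<longleftrightarrow> (\<forall>x\<in>A. \<forall>y\<in>A. g x = g y \<longrightarrow> f x = f y)"
proof -
  define h where "h z = g (inv_into A f z)" for z
  have h: "h (f x) = g x" if "x \<in> A" for x
    unfolding h_def by (intro factor inv_into_into f_inv_into_f imageI that)
  then have img: "g ` A = h ` f ` A" by (force simp: image_image)
  have "card (f ` A) = card (g ` A) \<longleftrightarrow> inj_on h (f ` A)"
    unfolding img using assms(1) by (metis card_image eq_card_imp_inj_on finite_imageI)
  also have "\<dots> \<longleftrightarrow> (\<forall>x\<in>A. \<forall>y\<in>A. g x = g y \<longrightarrow> f x = f y)"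
    using h by (auto simp: inj_on_def)
  finally show ?thesis .
qed

text \<open>A color class \<open>G\<close> and its detachment \<open>K\<close>. Only incidences are
  recorded, since connectivity does not see multiplicities; hinges are abstract, with edge
  \<open>ed\<close> and part \<open>f\<close>.\<close>

locale vertex_detachment =
  fixes G :: "('a, 'e) hypergraph" and K :: "('a dvertex, 'e) hypergraph" and \<alpha> :: 'a and n :: nat
    and S :: "'h set" and ed :: "'h \<Rightarrow> 'e" and f :: "'h \<Rightarrow> nat"
  assumes G: "hypergraph G" and K: "hypergraph K" and \<alpha>: "\<alpha> \<in> hverts G" and n: "n \<ge> 1"
    and hverts_K: "hverts K = Orig ` (hverts G - {\<alpha>}) \<union> Part ` {1..n}"
    and hedges_K: "hedges K = hedges G"
    and Orig_K: "\<And>e v. e \<in> hedges G \<Longrightarrow> Orig v \<in># hends K e \<longleftrightarrow> v \<noteq> \<alpha> \<and> v \<in># hends G e"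
    and Part_K: "\<And>e i. e \<in> hedges G \<Longrightarrow> Part i \<in># hends K e \<longleftrightarrow> (\<exists>h\<in>S. ed h = e \<and> f h = i)"
    and S: "finite S" "f ` S \<subseteq> {1..n}" "ed ` S = {e \<in> hedges G. \<alpha> \<in># hends G e}"
begin

definition merge :: "'a dvertex \<Rightarrow> 'a" where
  "merge x = (case x of Orig v \<Rightarrow> v | Part i \<Rightarrow> \<alpha>)"

lemma merge_simps [simp]: "merge (Orig v) = v" "merge (Part i) = \<alpha>"
  by (simp_all add: merge_def)

lemma ends_lift:
  assumes "e \<in> hedges G" "v \<in># hends G e"
  obtains x where "x \<in># hends K e" "merge x = v"
proof (cases "v = \<alpha>")
  case True
  then have "e \<in> ed ` S" using S(3) assms by blast
  then obtain h where "h \<in> S" "ed h = e" by blast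
  then have "Part (f h) \<in># hends K e" using Part_K assms by blast
  then show ?thesis using that True by simp
next
  case False
  then have "Orig v \<in># hends K e" using Orig_K assms by blast
  then show ?thesis using that by simp
qed

lemma merge_ends:
  assumes "e \<in> hedges G" "x \<in># hends K e"
  shows "merge x \<in># hends G e"
proof (cases x)
  case (Part i)
  then have "e \<in> ed ` S" using Part_K assms by blast
  then show ?thesis using S(3) Part by simp
qed (use Orig_K assms in auto)

lemma merge_image: "merge ` hverts K = hverts G"
proof -
  have "1 \<in> {1..n}" using n by simp
  then show ?thesis using \<alpha> by (auto simp: hverts_K image_Un image_image)
qed

lemma reach_merge:
  assumes "(x, y) \<in> hg_reach K"
  shows "(merge x, merge y) \<in> hg_reach G"
proof -
  have "(x, y) \<in> (hg_adj K)\<^sup>*" using assms by (simp add: hg_reach_def)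
  then have "(merge x, merge y) \<in> (hg_adj G)\<^sup>*"
  proof (induction rule: rtrancl_induct)
    case (step y z)
    then have "(merge y, merge z) \<in> hg_adj G" using merge_ends hedges_K by (auto simp: hg_adj_def)
    with step.IH show ?case by (rule rtrancl_into_rtrancl)
  qed simp
  then show ?thesis using assms merge_image by (auto simp: hg_reach_def)
qed

text \<open>A path lifts edge by edge; two lifts of the same vertex either agree or are parts, which
  \<open>parts\<close> joins.\<close>

lemma reach_lift:
  assumes parts: "\<And>i j. i \<in> {1..n} \<Longrightarrow> j \<in> {1..n} \<Longrightarrow> (Part i, Part j) \<in> hg_reach K"
    and "(u, v) \<in> (hg_adj G)\<^sup>*" "x \<in> hverts K" "y \<in> hverts K" "merge x = u" "merge y = v"
  shows "(x, y) \<in> hg_reach K"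
proof -
  have same: "(x, y) \<in> hg_reach K" if "x \<in> hverts K" "y \<in> hverts K" "merge x = merge y" for x y
    using that parts by (auto simp: hverts_K) (auto simp: hg_reach_def hverts_K)
  from assms(2) have "\<forall>y\<in>hverts K. merge y = v \<longrightarrow> (x, y) \<in> hg_reach K"
  proof (induction rule: rtrancl_induct)
    case base
    then show ?case using same assms(3,5) by simp
  next
    case (step v w)
    show ?case
    proof (intro ballI impI)
      fix y assume y: "y \<in> hverts K" "merge y = w"
      obtain e where e: "e \<in> hedges G" "v \<in># hends G e" "w \<in># hends G e"
        using step.hyps(2) by (auto simp: hg_adj_def)
      obtain a b where ab: "a \<in># hends K e" "merge a = v" "b \<in># hends K e" "merge b = w"
        using ends_lift[OF e(1,2)] ends_lift[OF e(1,3)] by metis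
      have abK: "a \<in> hverts K" "b \<in> hverts K" using hypergraph_ends_subset[OF K] e(1) hedges_K ab by auto
      have "(x, a) \<in> hg_reach K" using step.IH abK ab by blast
      moreover have "(a, b) \<in> hg_reach K"
        using ab abK e(1) hedges_K by (auto simp: hg_reach_def hg_adj_def intro!: r_into_rtrancl)
      moreover have "(b, y) \<in> hg_reach K" using same abK y ab by simp
      ultimately show "(x, y) \<in> hg_reach K" using hg_reach_trans[of x a K b] hg_reach_trans[of x b K y] by blast
    qed
  qed
  then show ?thesis using assms by blast
qed

text \<open>\<open>merge\<close> induces a surjection from the components of \<open>K\<close> to
  those of \<open>G\<close>. Only \<alpha> can have several preimages, so components are identified
  only through the parts.\<close>

lemma num_components_eq_iff:
  "hg_num_components K = hg_num_components G \<longleftrightarrow> (\<forall>i\<in>{1..n}. \<forall>j\<in>{1..n}. (Part i, Part j) \<in> hg_reach K)"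
proof -
  let ?f = "\<lambda>x. hg_reach K `` {x}" and ?g = "\<lambda>x. hg_reach G `` {merge x}"
  have merge_in: "merge x \<in> hverts G" if "x \<in> hverts K" for x using that merge_image by blast
  have f: "?f x = ?f y \<longleftrightarrow> (x, y) \<in> hg_reach K" if "x \<in> hverts K" "y \<in> hverts K" for x y
    using eq_equiv_class_iff[OF equiv_hg_reach that] .
  have g: "?g x = ?g y \<longleftrightarrow> (merge x, merge y) \<in> hg_reach G" if "x \<in> hverts K" "y \<in> hverts K" for x y
    using eq_equiv_class_iff[OF equiv_hg_reach merge_in merge_in] that by blast
  have "hverts K // hg_reach K = ?f ` hverts K" by (auto simp: quotient_def)
  moreover have "hverts G // hg_reach G = ?g ` hverts K" 
    unfolding merge_image[symmetric] by (auto simp: quotient_def)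
  ultimately have "hg_num_components K = hg_num_components G \<longleftrightarrow> card (?f ` hverts K) = card (?g ` hverts K)"
    by (simp add: hg_num_components_def)
  also have "\<dots> \<longleftrightarrow> (\<forall>x\<in>hverts K. \<forall>y\<in>hverts K. ?g x = ?g y \<longrightarrow> ?f x = ?f y)"
  proof (rule card_image_eq_iff_factor)
    show "finite (hverts K)" using K by (simp add: hypergraph_def)
    show "?g x = ?g y" if "x \<in> hverts K" "y \<in> hverts K" "?f x = ?f y" for x y
      using that f g reach_merge by blast
  qed
  also have "\<dots> \<longleftrightarrow> (\<forall>x\<in>hverts K. \<forall>y\<in>hverts K. (merge x, merge y) \<in> hg_reach G \<longrightarrow> (x, y) \<in> hg_reach K)"
    using f g by (intro ball_cong refl) simp
  also have "\<dots> \<longleftrightarrow> (\<forall>i\<in>{1..n}. \<forall>j\<in>{1..n}. (Part i, Part j) \<in> hg_reach K)"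
  proof
    assume *: "\<forall>x\<in>hverts K. \<forall>y\<in>hverts K. (merge x, merge y) \<in> hg_reach G \<longrightarrow> (x, y) \<in> hg_reach K"
    show "\<forall>i\<in>{1..n}. \<forall>j\<in>{1..n}. (Part i, Part j) \<in> hg_reach K"
    proof (intro ballI)
      fix i j assume "i \<in> {1..n}" "j \<in> {1..n}"
      then have "Part i \<in> hverts K" "Part j \<in> hverts K" by (simp_all add: hverts_K)
      moreover have "(\<alpha>, \<alpha>) \<in> hg_reach G" using \<alpha> by (simp add: hg_reach_def)
      ultimately show "(Part i, Part j) \<in> hg_reach K" using *[rule_format, of "Part i" "Part j"] by simp
    qed
  next
    assume *: "\<forall>i\<in>{1..n}. \<forall>j\<in>{1..n}. (Part i, Part j) \<in> hg_reach K"
    show "\<forall>x\<in>hverts K. \<forall>y\<in>hverts K. (merge x, merge y) \<in> hg_reach G \<longrightarrow> (x, y) \<in> hg_reach K"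
    proof (intro ballI impI)
      fix x y assume xy: "x \<in> hverts K" "y \<in> hverts K" "(merge x, merge y) \<in> hg_reach G"
      show "(x, y) \<in> hg_reach K"
      proof (rule reach_lift[OF _ _ xy(1,2) refl refl])
        show "(merge x, merge y) \<in> (hg_adj G)\<^sup>*" using xy(3) by (simp add: hg_reach_def)
      qed (rule *[rule_format])
    qed
  qed
  finally show ?thesis .
qed

section \<open>Paths between parts and links between hinges\<close>

definition wing :: "'h \<Rightarrow> 'e set" where
  "wing h = wing_edges G \<alpha> (ed h)"

lemma wing_eq_iff: "wing h = wing h' \<longleftrightarrow> (ed h, ed h') \<in> edge_link G \<alpha>"
  by (simp add: wing_def wing_edges_eq_iff)

lemma num_wings: "hg_num_wings G \<alpha> = card (wing ` S)"
proof -
  have "wing ` S = wing_edges G \<alpha> ` ed ` S" by (auto simp: wing_def)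
  then show ?thesis by (simp add: hg_num_wings_eq[OF G \<alpha>] S(3))
qed

lemma edge_link_imp_reach:
  assumes "(e, e') \<in> edge_link G \<alpha>" "e \<in> hedges G" "x \<in># hends K e" "y \<in># hends K e'" "e' \<in> hedges G"
  shows "(x, y) \<in> (hg_adj K)\<^sup>*"
proof -
  have "e' \<in> {e. \<forall>y. y \<in># hends K e \<longrightarrow> (x, y) \<in> (hg_adj K)\<^sup>*}"
  proof (rule edge_link_closed[OF assms(1)])
    show "e \<in> {e. \<forall>y. y \<in># hends K e \<longrightarrow> (x, y) \<in> (hg_adj K)\<^sup>*}"
      using assms(2,3) hedges_K by (auto simp: hg_adj_def intro!: r_into_rtrancl)
  next
    fix a b v assume a: "a \<in> {e. \<forall>y. y \<in># hends K e \<longrightarrow> (x, y) \<in> (hg_adj K)\<^sup>*}"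
      and ab: "a \<in> hedges G" "b \<in> hedges G" "v \<noteq> \<alpha>" "v \<in># hends G a" "v \<in># hends G b"
    have v: "Orig v \<in># hends K a" "Orig v \<in># hends K b" using ab Orig_K by auto
    have "(x, y) \<in> (hg_adj K)\<^sup>*" if "y \<in># hends K b" for y
    proof (rule rtrancl_into_rtrancl)
      show "(x, Orig v) \<in> (hg_adj K)\<^sup>*" using a v by blast
      show "(Orig v, y) \<in> hg_adj K" using v that ab hedges_K by (auto simp: hg_adj_def)
    qed
    then show "b \<in> {e. \<forall>y. y \<in># hends K e \<longrightarrow> (x, y) \<in> (hg_adj K)\<^sup>*}" by blast
  qed
  then show ?thesis using assms(4) by blast
qed

lemma linked_imp_reach:
  assumes "(h, h') \<in> linked wing f S" "h \<in> S"
  shows "(Part (f h), Part (f h')) \<in> (hg_adj K)\<^sup>*"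
  using assms(1) unfolding linked_def
proof (induction rule: rtrancl_induct)
  case (step a b)
  then have ab: "a \<in> S" "b \<in> S" "wing a = wing b \<or> f a = f b" by auto
  have "(Part (f a), Part (f b)) \<in> (hg_adj K)\<^sup>*"
  proof (cases "f a = f b")
    case False
    have "ed a \<in> hedges G" "ed b \<in> hedges G" using ab S(3) by blast+
    moreover from this have "Part (f a) \<in># hends K (ed a)" "Part (f b) \<in># hends K (ed b)"
      using ab Part_K by blast+
    moreover have "(ed a, ed b) \<in> edge_link G \<alpha>" using ab False wing_eq_iff by blast
    ultimately show ?thesis by (intro edge_link_imp_reach)
  qed simp
  with step.IH show ?case by (rule rtrancl_trans)
qed simp

lemma reach_imp_linked:
  assumes "(Part (f h), Part (f h')) \<in> (hg_adj K)\<^sup>*" "h \<in> S" "h' \<in> S"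
  shows "(h, h') \<in> linked wing f S"
proof -
  \<comment> \<open>A path may pass through original vertices, which belong to no single hinge. Such
    a vertex stands for the wing around it, so all hinges of that wing are required to be linked to
    \<open>h\<close>.\<close>
  define good where "good x = (case x of
      Part i \<Rightarrow> \<forall>g\<in>S. f g = i \<longrightarrow> (h, g) \<in> linked wing f S
    | Orig v \<Rightarrow> \<forall>g\<in>S. \<forall>e\<in>hedges G. v \<noteq> \<alpha> \<and> v \<in># hends G e \<and> (e, ed g) \<in> edge_link G \<alpha> \<longrightarrow> (h, g) \<in> linked wing f S)"
    for x
  have link: "(h, b) \<in> linked wing f S"
    if "(h, a) \<in> linked wing f S" "a \<in> S" "b \<in> S" "wing a = wing b \<or> f a = f b" for a b
    using linked_trans[OF that(1) linked_step[OF that(2-4)]] .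
  have good_Orig: "(h, g) \<in> linked wing f S"
    if "good (Orig v)" "g \<in> S" "e \<in> hedges G" "v \<noteq> \<alpha>" "v \<in># hends G e" "(e, ed g) \<in> edge_link G \<alpha>" for v g e
    using that unfolding good_def dvertex.case by blast
  have edge: "(h, g) \<in> linked wing f S" if e: "e \<in> hedges G" "x \<in># hends K e" "good x" and g: "g \<in> S" "ed g = e" for e x g
  proof (cases x)
    case (Part i)
    then obtain a where a: "a \<in> S" "ed a = e" "f a = i" using Part_K e by blast
    then have "(h, a) \<in> linked wing f S" using e(3) Part by (simp add: good_def)
    then show ?thesis using a g by (intro link[of a g]) (auto simp: wing_def)
  next
    case (Orig v)
    then have v: "v \<noteq> \<alpha>" "v \<in># hends G e" using Orig_K e by blast+
    have "(e, ed g) \<in> edge_link G \<alpha>" using g edge_link_refl by simp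
    then show ?thesis by (rule good_Orig[OF e(3)[unfolded Orig] g(1) e(1) v])
  qed
  have edge': "(h, g) \<in> linked wing f S"
    if e: "e \<in> hedges G" "x \<in># hends K e" "good x" and g: "g \<in> S" "(e, ed g) \<in> edge_link G \<alpha>" for e x g
  proof (cases x)
    case (Part i)
    then obtain a where a: "a \<in> S" "ed a = e" "f a = i" using Part_K e by blast
    then show ?thesis using edge[OF e a(1,2)] g wing_eq_iff by (intro link[of a g]) auto
  next
    case (Orig v)
    then have v: "v \<noteq> \<alpha>" "v \<in># hends G e" using Orig_K e by blast+
    show ?thesis by (rule good_Orig[OF e(3)[unfolded Orig] g(1) e(1) v g(2)])
  qed
  have step: "good y" if xy: "(x, y) \<in> hg_adj K" "good x" for x y
  proof -
    obtain e where e: "e \<in> hedges G" "x \<in># hends K e" "y \<in># hends K e"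
      using xy hedges_K by (auto simp: hg_adj_def)
    show ?thesis
    proof (cases y)
      case (Part i)
      then obtain a where a: "a \<in> S" "ed a = e" "f a = i" using Part_K e by blast
      have "(h, a) \<in> linked wing f S" using edge[OF e(1,2) xy(2) a(1,2)] .
      then show ?thesis using a Part link by (simp add: good_def)
    next
      case (Orig v)
      then have v: "v \<noteq> \<alpha>" "v \<in># hends G e" using Orig_K e by blast+
      have "(h, g) \<in> linked wing f S"
        if g: "g \<in> S" "e' \<in> hedges G" "v \<in># hends G e'" "(e', ed g) \<in> edge_link G \<alpha>" for g e'
        using edge_link_trans[OF edge_link_step[OF e(1) g(2) v g(3)] g(4)]
        by (rule edge'[OF e(1,2) xy(2) g(1)])
      then show ?thesis unfolding good_def Orig dvertex.case by blast
    qed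
  qed
  have "good (Part (f h))" using assms(2) by (auto simp: good_def intro!: linked_step)
  with assms(1) have "good (Part (f h'))" by (induction rule: rtrancl_induct) (use step in auto)
  then show ?thesis using assms(3) by (simp add: good_def)
qed

text \<open>\<open>linked\<close> does not see parts without hinges, so each direction must first
  show that every part has one: two or more connected parts all lie on edges, and conversely the
  inequality together with at least one wing gives \<open>n \<le> card S\<close>.\<close>

lemma components_eq_iff_degree:
  assumes linked: "n + card (wing ` S) \<le> card S + 1 \<Longrightarrow> \<forall>x\<in>S. \<forall>y\<in>S. (x, y) \<in> linked wing f S"
    and onto: "n \<le> card S \<Longrightarrow> f ` S = {1..n}"
  shows "hg_num_components K = hg_num_components G \<longleftrightarrow> n + hg_num_wings G \<alpha> \<le> card S + 1"
  unfolding num_components_eq_iff num_wings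
proof
  assume reach: "\<forall>i\<in>{1..n}. \<forall>j\<in>{1..n}. (Part i, Part j) \<in> hg_reach K"
  show "n + card (wing ` S) \<le> card S + 1"
  \<comment> \<open>A single part may lie on no edge, but then the inequality only says that there
    are no more wings than hinges.\<close>
  proof (cases "n = 1")
    case True
    then show ?thesis using card_image_le[OF S(1), of wing] by simp
  next
    case False
    have "i \<in> f ` S" if i: "i \<in> {1..n}" for i
    proof -
      obtain j where j: "j \<in> {1..n}" "j \<noteq> i"
        using i n False by (metis One_nat_def Suc_leI atLeastAtMost_iff le_antisym le_refl)
      then have "(Part i, Part j) \<in> (hg_adj K)\<^sup>*" using reach i by (auto simp: hg_reach_def)
      then obtain y where "(Part i, y) \<in> hg_adj K"
        using j(2) by (cases rule: converse_rtranclE) auto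
      then show ?thesis using Part_K hedges_K by (auto simp: hg_adj_def)
    qed
    then have fS: "f ` S = {1..n}" using S(2) by blast
    have "(x, y) \<in> linked wing f S" if "x \<in> S" "y \<in> S" for x y
      using reach S(2) that by (intro reach_imp_linked) (auto simp: hg_reach_def)
    from linked_imp_card_le[OF S(1) this] show ?thesis unfolding fS by simp
  qed
next
  assume le: "n + card (wing ` S) \<le> card S + 1"
  show "\<forall>i\<in>{1..n}. \<forall>j\<in>{1..n}. (Part i, Part j) \<in> hg_reach K"
  proof (intro ballI)
    fix i j assume ij: "i \<in> {1..n}" "j \<in> {1..n}"
    then have verts: "Part i \<in> hverts K" "Part j \<in> hverts K" by (auto simp: hverts_K)
    show "(Part i, Part j) \<in> hg_reach K"
    \<comment> \<open>Without hinges the inequality forces \<open>n = 1\<close>.\<close>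
    proof (cases "S = {}")
      case True
      then have "i = j" using le ij by simp
      then show ?thesis using verts by (simp add: hg_reach_def)
    next
      case False
      then have "card (wing ` S) \<ge> 1" using S(1) by (simp add: Suc_le_eq card_gt_0_iff)
      then have "f ` S = {1..n}" using le by (intro onto) linarith
      then obtain x y where "x \<in> S" "f x = i" "y \<in> S" "f y = j" using ij by (metis imageE)
      then show ?thesis using linked[OF le] linked_imp_reach[of x y] verts by (auto simp: hg_reach_def)
    qed
  qed
qed

end

section \<open>The detachment\<close>

text \<open>\<open>(m + c - 1) div c\<close> is the ceiling of \<open>m / c\<close> in natural
  numbers.\<close>

lemma approx_eqI:
  fixes x m c :: nat
  assumes c: "c > 0" and "m div c \<le> x" "x \<le> (m + c - 1) div c"
  shows "approx_eq (real x) (real m / real c)"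
proof -
  have "\<lfloor>real m / real c\<rfloor> \<le> int x" using assms(2) by (simp add: floor_divide_of_nat_eq)
  moreover have "x * c < m + c"
  proof -
    have "x * c \<le> (m + c - 1) div c * c" using assms(3) by (rule mult_right_mono) simp
    also have "\<dots> \<le> m + c - 1" by (rule div_times_less_eq_dividend)
    finally show ?thesis using c by linarith
  qed
  then have "real x * real c < real m + real c" by (metis of_nat_add of_nat_less_iff of_nat_mult)
  then have "real x - 1 < real m / real c" using c by (simp add: field_simps)
  then have "int x \<le> \<lceil>real m / real c\<rceil>" by (simp add: le_ceiling_iff)
  ultimately show ?thesis unfolding approx_eq_def by linarith
qed

lemma le_ceiling_div_mult:
  fixes m c :: nat
  assumes "c > 0"
  shows "m \<le> (m + c - 1) div c * c"
proof -
  have "m + c - 1 < (m + c - 1) div c * c + c" using dividend_less_div_times[OF assms, of "m + c - 1"] by linarith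
  then show ?thesis by linarith
qed

lemma sum_card_fibres:
  assumes "finite S" "finite A" "ed ` S \<subseteq> A"
  shows "(\<Sum>e\<in>{e\<in>A. q e}. card {h\<in>S. ed h = e \<and> p h}) = card {h\<in>S. q (ed h) \<and> p h}"
proof -
  have "card {h\<in>S. q (ed h) \<and> p h} = (\<Sum>e\<in>{e\<in>A. q e}. card {h \<in> {h\<in>S. q (ed h) \<and> p h}. ed h = e})"
    using sum.group[of "{h\<in>S. q (ed h) \<and> p h}" "{e\<in>A. q e}" ed "\<lambda>_. 1::nat"] assms by fastforce
  also have "\<dots> = (\<Sum>e\<in>{e\<in>A. q e}. card {h\<in>S. ed h = e \<and> p h})"
    by (intro sum.cong refl arg_cong[where f = card]) auto
  finally show ?thesis by simp
qed

lemma sum_replicate_Part: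
  assumes "P \<subseteq> {1..n}"
  shows "(\<Sum>i=1..n. replicate_mset (if i \<in> P then 1 else 0) (Part i)) = mset_set (Part ` P)"
proof (rule multiset_eqI)
  fix x :: "'a dvertex"
  have fin: "finite (Part ` P)" using assms finite_subset by blast
  show "count (\<Sum>i=1..n. replicate_mset (if i \<in> P then 1 else 0) (Part i)) x = count (mset_set (Part ` P)) x"
  proof (cases x)
    case (Orig v)
    then show ?thesis using fin by (auto simp: count_sum count_mset_set')
  next
    case (Part j)
    have "(\<Sum>i=1..n. count (replicate_mset (if i \<in> P then 1 else 0) (Part i)) x)
      = (\<Sum>i=1..n. if i = j then (if j \<in> P then 1 else 0) else 0)"
      using Part by (intro sum.cong) auto
    then show ?thesis using fin assms Part by (auto simp: count_sum count_mset_set')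
  qed
qed

section \<open>Color classes and the detachment given by an assignment of hinges\<close>

definition restrict_colour :: "('e \<Rightarrow> nat) \<Rightarrow> nat option \<Rightarrow> ('a, 'e) hypergraph \<Rightarrow> ('a, 'e) hypergraph" where
  "restrict_colour col c G = G\<lparr>hedges := {e \<in> hedges G. colour_matches c (col e)}\<rparr>"

lemma restrict_colour_None: "restrict_colour col None G = G"
  by (simp add: restrict_colour_def colour_matches_def)

lemma restrict_colour_Some: "restrict_colour col (Some j) G = color_class G col j"
  by (simp add: restrict_colour_def color_class_def colour_matches_def eq_commute)

lemma restrict_colour_sel [simp]:
  "hverts (restrict_colour col c G) = hverts G" "hends (restrict_colour col c G) = hends G"
  "hedges (restrict_colour col c G) = {e \<in> hedges G. colour_matches c (col e)}"
  by (simp_all add: restrict_colour_def)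

lemma hypergraph_restrict_colour: "hypergraph G \<Longrightarrow> hypergraph (restrict_colour col c G)"
  by (auto simp: hypergraph_def)

lemma linked_cong: "(\<And>x. x \<in> S \<Longrightarrow> w x = w' x) \<Longrightarrow> linked w f S = linked w' f S"
  unfolding linked_def by (intro arg_cong[where f = rtrancl]) auto

lemma count_image_Orig_Part [simp]: "count (image_mset Orig Y) (Part i) = 0"
  by (auto simp: count_eq_zero_iff)

lemma card_Sigma_fibre:
  assumes "e \<in> A"
  shows "card {h \<in> Sigma A (\<lambda>e. {..<c e :: nat}). fst h = e} = c e"
proof -
  have "{h \<in> Sigma A (\<lambda>e. {..<c e}). fst h = e} = Pair e ` {..<c e}" using assms by auto
  then show ?thesis by (simp add: card_image inj_on_def)
qed

locale hinge_assignment =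
  fixes H :: "('a, 'e) hypergraph" and \<alpha> :: 'a and n :: nat and S :: "('e \<times> nat) set" and f :: "'e \<times> nat \<Rightarrow> nat"
  assumes H: "hypergraph H" and \<alpha>: "\<alpha> \<in> hverts H" and n: "n \<ge> 1"
    and S_def: "S = Sigma (hedges H) (\<lambda>e. {..<count (hends H e) \<alpha>})"
    and f_range: "f ` S \<subseteq> {1..n}"
    and f_inj: "\<And>e. e \<in> hedges H \<Longrightarrow> inj_on f {h\<in>S. fst h = e}"
begin

definition parts :: "'e \<Rightarrow> nat set" where
  "parts e = f ` {h\<in>S. fst h = e}"

definition F :: "('a dvertex, 'e) hypergraph" where
  "F = \<lparr>hverts = Orig ` (hverts H - {\<alpha>}) \<union> Part ` {1..n}, hedges = hedges H,
     hends = (\<lambda>e. mset_set (Part ` parts e) + image_mset Orig (filter_mset (\<lambda>v. v \<noteq> \<alpha>) (hends H e)))\<rparr>"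

lemma F_sel [simp]:
  "hverts F = Orig ` (hverts H - {\<alpha>}) \<union> Part ` {1..n}" "hedges F = hedges H"
  "hends F e = mset_set (Part ` parts e) + image_mset Orig (filter_mset (\<lambda>v. v \<noteq> \<alpha>) (hends H e))"
  by (simp_all add: F_def)

lemma finite_hedges: "finite (hedges H)"
  using H by (simp add: hypergraph_def)

lemma finite_S: "finite S"
  using finite_hedges by (simp add: S_def)

lemma fst_S: "fst ` S \<subseteq> hedges H"
  by (auto simp: S_def)

lemma card_hinges: "e \<in> hedges H \<Longrightarrow> card {h\<in>S. fst h = e} = count (hends H e) \<alpha>"
  by (simp add: S_def card_Sigma_fibre)

lemma parts_subset: "parts e \<subseteq> {1..n}"
  using f_range by (auto simp: parts_def)

lemma finite_parts: "finite (parts e)"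
  using parts_subset finite_subset by blast

lemma card_parts: "e \<in> hedges H \<Longrightarrow> card (parts e) = count (hends H e) \<alpha>"
  by (simp add: parts_def card_image f_inj card_hinges)

lemma hypergraph_F: "hypergraph F"
  unfolding hypergraph_def
proof (intro conjI ballI)
  show "finite (hverts F)" "finite (hedges F)" using H by (auto simp: hypergraph_def)
  fix e assume "e \<in> hedges F"
  then have e: "e \<in> hedges H" by simp
  show "set_mset (hends F e) \<subseteq> hverts F"
    using parts_subset[of e] finite_parts hypergraph_ends_subset[OF H e] by auto
  have "hends H e \<noteq> {#}" using H e unfolding hypergraph_def by blast
  then obtain v where v: "v \<in># hends H e" by blast
  show "hends F e \<noteq> {#}"
  proof (cases "v = \<alpha>")
    case True
    then have "parts e \<noteq> {}" using card_parts[OF e] v by (auto simp: count_eq_zero_iff)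
    then show ?thesis using finite_parts by (simp add: mset_set_empty_iff)
  next
    case False
    then have "v \<in># filter_mset (\<lambda>v. v \<noteq> \<alpha>) (hends H e)" using v by simp
    then show ?thesis by auto
  qed
qed

lemma detachment_F: "detachment H \<alpha> n F"
  unfolding detachment_def
proof (intro conjI ballI)
  fix e assume e: "e \<in> hedges H"
  let ?p = "\<lambda>i. if i \<in> parts e then 1 else 0 :: nat"
  have "(\<Sum>i=1..n. ?p i) = card (parts e)"
    using parts_subset[of e] by (simp add: sum.If_cases Int_absorb1)
  then show "\<exists>p. (\<Sum>i=1..n. p i) = count (hends H e) \<alpha> \<and>
      hends F e = (\<Sum>i=1..n. replicate_mset (p i) (Part i)) + image_mset Orig (filter_mset (\<lambda>v. v \<noteq> \<alpha>) (hends H e))"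
    using card_parts[OF e] by (intro exI[of _ ?p]) (simp only: F_sel(3) sum_replicate_Part[OF parts_subset])
qed (simp_all add: hypergraph_F)

lemma count_F_Part:
  assumes e: "e \<in> hedges H"
  shows "count (hends F e) (Part i) = card {h\<in>S. fst h = e \<and> f h = i}"
proof -
  have "count (hends F e) (Part i) = (if i \<in> parts e then 1 else 0)"
    using finite_parts[of e] by (auto simp: count_mset_set')
  also have "\<dots> = card {h\<in>S. fst h = e \<and> f h = i}"
  proof (cases "i \<in> parts e")
    case True
    then obtain h where h: "h \<in> S" "fst h = e" "f h = i" by (auto simp: parts_def)
    then have "{h\<in>S. fst h = e \<and> f h = i} = {h}" using f_inj[OF e] by (auto dest: inj_onD)
    then show ?thesis using True by simp
  next
    case False
    then have "{h\<in>S. fst h = e \<and> f h = i} = {}" by (auto simp: parts_def)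
    then show ?thesis using False by (simp only: card.empty if_False)
  qed
  finally show ?thesis .
qed

lemma simple_F: "detachment_simple n F"
  unfolding detachment_simple_def
proof (intro ballI)
  fix e i assume "e \<in> hedges F"
  then have e: "e \<in> hedges H" by simp
  have "finite {h\<in>S. fst h = e \<and> f h = i}" using finite_S by simp
  then show "count (hends F e) (Part i) \<le> 1"
    unfolding count_F_Part[OF e] using f_inj[OF e] by (auto simp: card_le_Suc0_iff_eq inj_on_def)
qed

lemma deg_F: "hg_deg (restrict_colour col c F) (Part i) = card {h\<in>S. colour_matches c (col (fst h)) \<and> f h = i}"
proof -
  have "hg_deg (restrict_colour col c F) (Part i)
    = (\<Sum>e\<in>{e\<in>hedges H. colour_matches c (col e)}. card {h\<in>S. fst h = e \<and> f h = i})"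
    unfolding hg_deg_def using count_F_Part by (intro sum.cong) (auto simp del: F_sel(3))
  then show ?thesis by (simp add: sum_card_fibres[OF finite_S finite_hedges fst_S])
qed

lemma deg_H: "hg_deg (restrict_colour col c H) \<alpha> = card {h\<in>S. colour_matches c (col (fst h))}"
proof -
  have "hg_deg (restrict_colour col c H) \<alpha>
    = (\<Sum>e\<in>{e\<in>hedges H. colour_matches c (col e)}. card {h\<in>S. fst h = e \<and> True})"
    unfolding hg_deg_def using card_hinges by (intro sum.cong) auto
  then show ?thesis using sum_card_fibres[OF finite_S finite_hedges fst_S, where q = "\<lambda>e. colour_matches c (col e)" and p = "\<lambda>_. True"] by simp
qed

text \<open>New and old vertices of an edge can be read off separately, and the parts of an edge
  form a set with as many elements as \<alpha> has occurrences. This turns multiplicities in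
  \<open>F\<close> into the counts of \<open>fair_assignment\<close>.\<close>

lemma hends_F_eq_iff:
  assumes e: "e \<in> hedges H" and U: "finite U" and X: "\<alpha> \<notin># X"
  shows "hends F e = mset_set (Part ` U) + image_mset Orig X \<longleftrightarrow>
    hends H e = replicate_mset (card U) \<alpha> + X \<and> parts e = U" (is "?l \<longleftrightarrow> ?r")
proof
  assume ?l
  then have filt: "filter_mset p (hends F e) = filter_mset p (mset_set (Part ` U) + image_mset Orig X)" for p by simp
  let ?isP = "\<lambda>x. case x of Part i \<Rightarrow> True | Orig v \<Rightarrow> False"
  have part: "filter_mset ?isP (mset_set (Part ` P) + image_mset Orig Y) = mset_set (Part ` P)" if "finite P" for P :: "nat set" and Y :: "'a multiset"
    using that by (intro multiset_eqI) (auto simp: count_mset_set' split: dvertex.splits)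
  have orig: "filter_mset (\<lambda>x. \<not> ?isP x) (mset_set (Part ` P) + image_mset Orig Y) = image_mset Orig Y" if "finite P" for P :: "nat set" and Y :: "'a multiset"
    using that by (intro multiset_eqI) (auto simp: count_mset_set' split: dvertex.splits)
  have "mset_set (Part ` parts e) = mset_set (Part ` U :: 'a dvertex set)"
    using filt[of ?isP] unfolding F_sel(3) part[OF finite_parts] part[OF U] .
  then have "Part ` parts e = (Part ` U :: 'a dvertex set)"
    using finite_parts U by (metis finite_imageI finite_set_mset_mset_set)
  then have pU: "parts e = U" by (simp add: inj_image_eq_iff inj_def)
  have "image_mset Orig (filter_mset (\<lambda>v. v \<noteq> \<alpha>) (hends H e)) = image_mset Orig X"
    using filt[of "\<lambda>x. \<not> ?isP x"] unfolding F_sel(3) orig[OF finite_parts] orig[OF U] .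
  then have "filter_mset (\<lambda>v. v \<noteq> \<alpha>) (hends H e) = X"
    by (metis dvertex.inject(1) injI multiset.inj_map_strong)
  moreover have "filter_mset (\<lambda>v. v = \<alpha>) (hends H e) = replicate_mset (card U) \<alpha>"
    using card_parts[OF e] pU by (simp add: filter_eq_replicate_mset)
  ultimately show ?r using pU multiset_partition[of "hends H e" "\<lambda>v. v = \<alpha>"] by simp
next
  assume r: ?r
  have "filter_mset (\<lambda>v. v \<noteq> \<alpha>) (replicate_mset (card U) \<alpha>) = {#}" by (intro multiset_eqI) auto
  moreover have "filter_mset (\<lambda>v. v \<noteq> \<alpha>) X = X" using X by (auto simp: filter_mset_eq_conv)
  ultimately show ?l using r by simp
qed

lemma mult_F:
  assumes "U \<subseteq> Part ` {1..n}" "\<alpha> \<notin># X"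
  obtains P where "P \<subseteq> {1..n}" "card P = card U"
    "hg_mult (restrict_colour col c F) (mset_set U + image_mset Orig X)
       = card {e\<in>hedges H. hends H e = replicate_mset (card P) \<alpha> + X \<and> colour_matches c (col e) \<and> parts e = P}"
    "hg_mult (restrict_colour col c H) (replicate_mset (card U) \<alpha> + X)
       = card {e\<in>hedges H. hends H e = replicate_mset (card P) \<alpha> + X \<and> colour_matches c (col e)}"
proof -
  obtain P where P: "P \<subseteq> {1..n}" "U = Part ` P" using assms(1) by (meson subset_imageE)
  then have finP: "finite P" using finite_subset by blast
  have cardP: "card P = card U" unfolding P(2) by (simp add: card_image inj_on_def)
  show ?thesis
  proof (rule that[OF P(1) cardP])
    show "hg_mult (restrict_colour col c F) (mset_set U + image_mset Orig X)
       = card {e\<in>hedges H. hends H e = replicate_mset (card P) \<alpha> + X \<and> colour_matches c (col e) \<and> parts e = P}"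
      unfolding hg_mult_def P(2) using hends_F_eq_iff[OF _ finP assms(2)]
      by (intro arg_cong[where f = card]) (auto simp del: F_sel(3))
    show "hg_mult (restrict_colour col c H) (replicate_mset (card U) \<alpha> + X)
       = card {e\<in>hedges H. hends H e = replicate_mset (card P) \<alpha> + X \<and> colour_matches c (col e)}"
      unfolding hg_mult_def cardP by (intro arg_cong[where f = card]) auto
  qed
qed

lemma components_F:
  fixes col :: "'e \<Rightarrow> nat" and j :: nat
  defines "S' \<equiv> {h\<in>S. col (fst h) = j}"
  assumes linked: "n + card ((\<lambda>h. wing_edges (color_class H col j) \<alpha> (fst h)) ` S') \<le> card S' + 1 \<Longrightarrow>
      \<forall>x\<in>S'. \<forall>y\<in>S'. (x, y) \<in> linked (\<lambda>h. wing_edges (color_class H col j) \<alpha> (fst h)) f S'"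
    and onto: "\<And>i. n \<le> card S' \<Longrightarrow> i \<in> {1..n} \<Longrightarrow> i \<in> f ` S'"
  shows "hg_num_components (color_class F col j) = hg_num_components (color_class H col j) \<longleftrightarrow>
    n + hg_num_wings (color_class H col j) \<alpha> \<le> hg_deg (color_class H col j) \<alpha> + 1"
proof -
  have sel: "hedges (color_class G col j) = {e \<in> hedges G. col e = j}" "hverts (color_class G col j) = hverts G"
    "hends (color_class G col j) = hends G" for G :: "('b, 'e) hypergraph"
    by (simp_all add: color_class_def)
  interpret vertex_detachment "color_class H col j" "color_class F col j" \<alpha> n S' fst f
  proof
    show "hypergraph (color_class H col j)" "hypergraph (color_class F col j)"
      using hypergraph_restrict_colour[OF H] hypergraph_restrict_colour[OF hypergraph_F]
      by (metis restrict_colour_Some)+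
    show "Orig v \<in># hends (color_class F col j) e \<longleftrightarrow> v \<noteq> \<alpha> \<and> v \<in># hends (color_class H col j) e" for e v
      using finite_parts[of e] by (auto simp: sel)
    show "Part i \<in># hends (color_class F col j) e \<longleftrightarrow> (\<exists>h\<in>S'. fst h = e \<and> f h = i)"
      if "e \<in> hedges (color_class H col j)" for e i
      using finite_parts[of e] that by (auto simp: sel parts_def S'_def)
    show "fst ` S' = {e \<in> hedges (color_class H col j). \<alpha> \<in># hends (color_class H col j) e}"
    proof (intro equalityI subsetI)
      fix e assume "e \<in> {e \<in> hedges (color_class H col j). \<alpha> \<in># hends (color_class H col j) e}"
      then have "(e, 0) \<in> S'" by (auto simp: S'_def S_def sel)
      then show "e \<in> fst ` S'" by force
    qed (auto simp: S'_def S_def sel intro: count_inI)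
  qed (use \<alpha> n finite_S f_range in \<open>auto simp: sel S'_def\<close>)
  have wing: "wing = (\<lambda>h. wing_edges (color_class H col j) \<alpha> (fst h))" by (simp add: wing_def fun_eq_iff)
  have "n \<le> card S' \<Longrightarrow> f ` S' = {1..n}" using onto f_range by (auto simp: S'_def)
  moreover have "hg_deg (color_class H col j) \<alpha> = card S'"
    using deg_H[of col "Some j"] by (simp add: restrict_colour_Some colour_matches_def S'_def eq_commute)
  ultimately show ?thesis using components_eq_iff_degree linked unfolding wing by simp
qed

end

theorem theorem1p1:
  fixes H :: "('a, 'e) hypergraph" and col :: "'e \<Rightarrow> nat" and \<alpha> :: 'a and k n :: nat
  assumes "k \<ge> 1" and "n \<ge> 1"
    and "hypergraph H"
    and "\<forall>e\<in>hedges H. col e \<in> {1..k}"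
    and "\<alpha> \<in> hverts H"
    and "\<And>t Y. t > n \<Longrightarrow> set_mset Y \<subseteq> hverts H \<Longrightarrow> hg_mult H (replicate_mset t \<alpha> + Y) = 0"
  shows "\<exists>F :: ('a dvertex, 'e) hypergraph.
    detachment H \<alpha> n F \<and> detachment_simple n F \<and>
    (\<forall>i\<in>{1..n}. approx_eq (hg_deg F (Part i)) (hg_deg H \<alpha> / n)) \<and>
    (\<forall>i\<in>{1..n}. \<forall>j\<in>{1..k}.
       approx_eq (hg_deg (color_class F col j) (Part i)) (hg_deg (color_class H col j) \<alpha> / n)) \<and>
    (\<forall>U X. U \<subseteq> Part ` {1..n} \<longrightarrow> set_mset X \<subseteq> hverts H - {\<alpha>} \<longrightarrow>
       approx_eq (hg_mult F (mset_set U + image_mset Orig X))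
         (hg_mult H (replicate_mset (card U) \<alpha> + X) / (n choose card U))) \<and>
    (\<forall>U X. \<forall>j\<in>{1..k}. U \<subseteq> Part ` {1..n} \<longrightarrow> set_mset X \<subseteq> hverts H - {\<alpha>} \<longrightarrow>
       approx_eq (hg_mult (color_class F col j) (mset_set U + image_mset Orig X))
         (hg_mult (color_class H col j) (replicate_mset (card U) \<alpha> + X) / (n choose card U))) \<and>
    (\<forall>j\<in>{1..k}.
       hg_num_components (color_class F col j) = hg_num_components (color_class H col j) \<longleftrightarrow>
       int (hg_deg (color_class H col j) \<alpha>) - int (hg_num_wings (color_class H col j) \<alpha>)
         \<ge> int n - 1)"
proof -
  note n = assms(2) and H = assms(3) and \<alpha> = assms(5)
  let ?A = "hedges H"
  have finA: "finite ?A" using H by (simp add: hypergraph_def)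
  have le_n: "count (hends H e) \<alpha> \<le> n" if e: "e \<in> ?A" for e
  proof (rule ccontr)
    \<comment> \<open>\<open>?Y\<close> is the rest of the edge, so the multiplicity hypothesis
      would say that the edge itself is absent.\<close>
    let ?t = "count (hends H e) \<alpha>" and ?Y = "filter_mset (\<lambda>v. v \<noteq> \<alpha>) (hends H e)"
    assume "\<not> ?t \<le> n"
    moreover have "set_mset ?Y \<subseteq> hverts H" using hypergraph_ends_subset[OF H e] by auto
    ultimately have "hg_mult H (replicate_mset ?t \<alpha> + ?Y) = 0" using assms(6) by simp
    moreover have "hends H e = replicate_mset ?t \<alpha> + ?Y"
      using multiset_partition[of "hends H e" "\<lambda>v. v = \<alpha>"] by (simp add: filter_eq_replicate_mset)
    then have "e \<in> {e' \<in> ?A. hends H e' = replicate_mset ?t \<alpha> + ?Y}" using e by blast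
    ultimately show False using finA by (auto simp: hg_mult_def)
  qed
  define S where "S = Sigma ?A (\<lambda>e. {..<count (hends H e) \<alpha>})"
  have finS: "finite S" and fstS: "fst ` S \<subseteq> ?A" using finA by (auto simp: S_def)
  \<comment> \<open>The type of an edge is its vertex multiset, coded as a number as
    \<open>fair_assignment\<close> requires.\<close>
  obtain code :: "'a multiset \<Rightarrow> nat" where code: "inj_on code (hends H ` ?A)"
    using finite_imp_inj_to_nat_seg[of "hends H ` ?A"] finA by blast
  define \<tau> where "\<tau> e = code (hends H e)" for e
  define r where "r x = count (inv_into (hends H ` ?A) code x) \<alpha>" for x
  have \<tau>_iff: "\<tau> e = \<tau> e' \<longleftrightarrow> hends H e = hends H e'" if "e \<in> ?A" "e' \<in> ?A" for e e'
    using code that by (auto simp: \<tau>_def dest: inj_onD)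
  have r: "r (\<tau> e) = count (hends H e) \<alpha>" if "e \<in> ?A" for e
    using code that by (simp add: r_def \<tau>_def)
  \<comment> \<open>Wings are taken in the color class of the hinge, which makes them
    monochromatic.\<close>
  define w where "w h = wing_edges (color_class H col (col (fst h))) \<alpha> (fst h)" for h :: "'e \<times> nat"
  have wc: "col (fst h) = col (fst h')" if h: "h \<in> S" "h' \<in> S" "w h = w h'" for h h'
  proof -
    have "fst h \<in> w h" by (simp add: w_def wing_edges_def edge_link_refl)
    moreover have "w h' \<subseteq> hedges (color_class H col (col (fst h')))"
      unfolding w_def using h(2) fstS by (intro wing_edges_subset) (auto simp: color_class_def)
    ultimately show ?thesis using h(3) by (auto simp: color_class_def)
  qed
  have card_hinges: "card {h\<in>S. fst h = e} = r (\<tau> e)" if "e \<in> ?A" for e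
    using that by (simp add: S_def card_Sigma_fibre r)
  let ?m = "\<lambda>x c. card {e\<in>?A. \<tau> e = x \<and> colour_matches c (col e)}"
  let ?d = "\<lambda>c. card {h\<in>S. colour_matches c (col (fst h))}"
  let ?C = "\<lambda>x. n choose r x"
  \<comment> \<open>A number that codes no edge may have \<open>r x > n\<close> and hence
    \<open>?C x = 0\<close>, which is why the empty type is treated separately.\<close>
  have m_up: "?m x c \<le> (?m x c + ?C x - 1) div ?C x * ?C x" for x c
  proof (cases "{e\<in>?A. \<tau> e = x \<and> colour_matches c (col e)} = {}")
    case True
    then show ?thesis by (simp only: card.empty)
  next
    case False
    then obtain e where "e \<in> ?A" "\<tau> e = x" by blast
    then have "r x \<le> n" using r le_n by metis
    then show ?thesis by (intro le_ceiling_div_mult) simp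
  qed
  obtain f where f: "f ` S \<subseteq> {1..n}" "\<forall>e\<in>?A. inj_on f {h\<in>S. fst h = e}"
    and ty: "\<forall>x c U. U \<subseteq> {1..n} \<longrightarrow> card U = r x \<longrightarrow>
       card {e\<in>?A. \<tau> e = x \<and> colour_matches c (col e) \<and> f ` {h\<in>S. fst h = e} = U}
         \<in> {?m x c div ?C x..(?m x c + ?C x - 1) div ?C x}"
    and dg: "\<forall>c. \<forall>i\<in>{1..n}. card {h\<in>S. colour_matches c (col (fst h)) \<and> f h = i}
         \<in> {?d c div n..(?d c + n - 1) div n}"
    and conn: "\<forall>j. n + card (w ` {h\<in>S. col (fst h) = j}) \<le> card {h\<in>S. col (fst h) = j} + 1 \<longrightarrow>
       (\<forall>x\<in>{h\<in>S. col (fst h) = j}. \<forall>y\<in>{h\<in>S. col (fst h) = j}. (x, y) \<in> linked w f {h\<in>S. col (fst h) = j})"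
  proof (rule exE[OF fair_assignment[where A = ?A and S = S and ed = fst and col = col and \<tau> = \<tau> and w = w
        and r = r and n = n and lo = "\<lambda>x c. ?m x c div ?C x" and hi = "\<lambda>x c. (?m x c + ?C x - 1) div ?C x"
        and dlo = "\<lambda>c. ?d c div n" and dhi = "\<lambda>c. (?d c + n - 1) div n", OF finA finS fstS]])
    show "r (\<tau> e) \<le> n" if "e \<in> ?A" for e using r le_n that by simp
    show "?d c \<le> (?d c + n - 1) div n * n" for c using n by (intro le_ceiling_div_mult) simp
  qed (rule m_up div_times_less_eq_dividend | rule card_hinges wc, assumption+ | elim conjE, rule that, assumption+)+
  interpret hinge_assignment H \<alpha> n S f
    by unfold_locales (use H \<alpha> n f S_def in auto)
  have deg: "approx_eq (hg_deg (restrict_colour col c F) (Part i)) (hg_deg (restrict_colour col c H) \<alpha> / n)"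
    if "i \<in> {1..n}" for c i
    unfolding deg_F deg_H using dg that n by (intro approx_eqI) auto
  have mult: "approx_eq (hg_mult (restrict_colour col c F) (mset_set U + image_mset Orig X))
      (hg_mult (restrict_colour col c H) (replicate_mset (card U) \<alpha> + X) / (n choose card U))"
    if U: "U \<subseteq> Part ` {1..n}" and X: "set_mset X \<subseteq> hverts H - {\<alpha>}" for c U X
  proof -
    have "\<alpha> \<notin># X" using X by blast
    from mult_F[OF U this, of col c] obtain P where P: "P \<subseteq> {1..n}" "card P = card U"
      and F: "hg_mult (restrict_colour col c F) (mset_set U + image_mset Orig X)
       = card {e\<in>?A. hends H e = replicate_mset (card P) \<alpha> + X \<and> colour_matches c (col e) \<and> parts e = P}"
      and H: "hg_mult (restrict_colour col c H) (replicate_mset (card U) \<alpha> + X)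
       = card {e\<in>?A. hends H e = replicate_mset (card P) \<alpha> + X \<and> colour_matches c (col e)}" .
    show ?thesis
    \<comment> \<open>A multiset that is no edge of \<open>H\<close> has no type; both
      multiplicities are then 0.\<close>
    proof (cases "\<exists>e\<in>?A. hends H e = replicate_mset (card P) \<alpha> + X")
      case True
      then obtain e where e: "e \<in> ?A" "hends H e = replicate_mset (card P) \<alpha> + X" by blast
      then have type: "hends H e' = replicate_mset (card P) \<alpha> + X \<longleftrightarrow> \<tau> e' = \<tau> e" if "e' \<in> ?A" for e'
        using \<tau>_iff[OF that e(1)] by simp
      have re: "card P = r (\<tau> e)" using r[OF e(1)] e(2) \<open>\<alpha> \<notin># X\<close> by (simp add: not_in_iff)
      have "card P \<le> n" using card_mono[OF _ P(1)] by simp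
      then have pos: "n choose card P > 0" by simp
      have "hg_mult (restrict_colour col c F) (mset_set U + image_mset Orig X)
         = card {e'\<in>?A. \<tau> e' = \<tau> e \<and> colour_matches c (col e') \<and> f ` {h\<in>S. fst h = e'} = P}"
        unfolding F parts_def using type by (intro arg_cong[where f = card]) auto
      moreover have "hg_mult (restrict_colour col c H) (replicate_mset (card U) \<alpha> + X) = ?m (\<tau> e) c"
        unfolding H using type by (intro arg_cong[where f = card]) auto
      ultimately show ?thesis
        using ty[rule_format, OF P(1) re, of c] pos unfolding P(2)[symmetric] re
        by (intro approx_eqI) auto
    next
      case False
      then have empty: "{e\<in>?A. hends H e = replicate_mset (card P) \<alpha> + X \<and> Q e} = {}" for Q by blast
      have "hg_mult (restrict_colour col c F) (mset_set U + image_mset Orig X) = 0"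
        "hg_mult (restrict_colour col c H) (replicate_mset (card U) \<alpha> + X) = 0"
        unfolding F H empty by simp_all
      then show ?thesis by (simp add: approx_eq_def)
    qed
  qed
  have comp: "hg_num_components (color_class F col j) = hg_num_components (color_class H col j) \<longleftrightarrow>
      n + hg_num_wings (color_class H col j) \<alpha> \<le> hg_deg (color_class H col j) \<alpha> + 1" for j
  proof (rule components_F)
    let ?S = "{h\<in>S. col (fst h) = j}" and ?w = "\<lambda>h :: 'e \<times> nat. wing_edges (color_class H col j) \<alpha> (fst h)"
    have w: "w h = ?w h" if "h \<in> ?S" for h using that by (simp add: w_def)
    assume "n + card (?w ` ?S) \<le> card ?S + 1"
    moreover have "w ` ?S = ?w ` ?S" using w by (intro image_cong) auto
    ultimately have "n + card (w ` ?S) \<le> card ?S + 1" by (simp only:)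
    moreover have "linked w f ?S = linked ?w f ?S" by (rule linked_cong) (rule w)
    ultimately show "\<forall>x\<in>?S. \<forall>y\<in>?S. (x, y) \<in> linked ?w f ?S"
      using conn[rule_format, of j] by (simp only:) blast
  next
    let ?S = "{h\<in>S. col (fst h) = j}"
    fix i assume le: "n \<le> card ?S" and i: "i \<in> {1..n}"
    have S: "?S = {h\<in>S. colour_matches (Some j) (col (fst h))}" by (auto simp: colour_matches_def)
    \<comment> \<open>With at least \<open>n\<close> hinges of color \<open>j\<close> the floor in
      (F2) is at least 1, so every part receives one of them.\<close>
    have "1 \<le> card ?S div n" using le n by (simp add: div_greater_zero_iff Suc_le_eq)
    also have "\<dots> \<le> card {h\<in>S. colour_matches (Some j) (col (fst h)) \<and> f h = i}"
      using dg i unfolding S by auto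
    finally have "{h\<in>S. colour_matches (Some j) (col (fst h)) \<and> f h = i} \<noteq> {}" by (metis card.empty not_one_le_zero)
    then show "i \<in> f ` ?S" by (auto simp: colour_matches_def)
  qed
  show ?thesis
  proof (intro exI[of _ F] conjI ballI allI impI)
    show "detachment H \<alpha> n F" "detachment_simple n F" by (rule detachment_F simple_F)+
  next
    fix j
    show "hg_num_components (color_class F col j) = hg_num_components (color_class H col j) \<longleftrightarrow>
       int (hg_deg (color_class H col j) \<alpha>) - int (hg_num_wings (color_class H col j) \<alpha>) \<ge> int n - 1"
      unfolding comp by linarith
  qed (use deg[of _ None] deg[of _ "Some _"] mult[of _ _ None] mult[of _ _ "Some _"] in
      \<open>simp_all only: restrict_colour_None restrict_colour_Some\<close>)
qed

end
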